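(* Let $A, B \in \mathbb{P}$ be such that $A \leq \alpha I$ and $B \leq \beta I$ for some $\alpha, \beta > 0$. Then $F_{t}(A, B) \leq \alpha^{1-t} \beta^{t} I$ for all $t \in [0,1]$.
   Context: $\mathbb{P}$ denotes the set of positive definite (i.e. positive invertible) bounded linear operators on a complex Hilbert space $\mathcal{H}$; $I$ is the identity operator and $\leq$ is the L\"owner order on bounded self-adjoint operators ($X \le Y$ iff $Y-X$ is positive semidefinite). Real powers of elements of $\mathbb{P}$ are defined by functional calculus. For $A,B\in\mathbb{P}$ and $t\in[0,1]$, the weighted (metric) geometric mean is $A \sharp_{t} B := A^{1/2} (A^{-1/2} B A^{-1/2})^{t} A^{1/2}$, and the new weighted spectral geometric mean is $F_{t}(A, B) := (A^{-1} \sharp_{t} B)^{1/2} A^{2-2t} (A^{-1} \sharp_{t} B)^{1/2}$. *)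

theory Defs
  imports "HOL-Analysis.Analysis" "HOL-Computational_Algebra.Polynomial"
begin

section \<open>Complex Hilbert spaces\<close>

class scaleC =
  fixes scaleC :: "complex \<Rightarrow> 'a \<Rightarrow> 'a"  (infixr \<open>*\<^sub>C\<close> 75)

text \<open>The inner product is linear in its first argument. Positive definiteness is contained in
  \<open>cinner_self\<close>, because \<open>norm\<close> is already a norm on a \<open>banach\<close> type.\<close>

class complex_hilbert_space = banach + scaleC +
  fixes cinner :: "'a \<Rightarrow> 'a \<Rightarrow> complex"
  assumes scaleC_add_right: "c *\<^sub>C (x + y) = c *\<^sub>C x + c *\<^sub>C y"
    and scaleC_add_left: "(c + d) *\<^sub>C x = c *\<^sub>C x + d *\<^sub>C x"
    and scaleC_scaleC: "c *\<^sub>C (d *\<^sub>C x) = (c * d) *\<^sub>C x"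
    and scaleC_of_real: "complex_of_real r *\<^sub>C x = r *\<^sub>R x"
    and cinner_commute: "cinner x y = cnj (cinner y x)"
    and cinner_add_left: "cinner (x + y) z = cinner x z + cinner y z"
    and cinner_scaleC_left: "cinner (c *\<^sub>C x) y = c * cinner x y"
    and cinner_self: "cinner x x = complex_of_real ((norm x)\<^sup>2)"

lemma norm_scaleC: "norm (c *\<^sub>C x) = cmod c * norm (x :: 'a::complex_hilbert_space)"
proof -
  have "cinner (c *\<^sub>C x) (c *\<^sub>C x) = c * cnj (c * cinner x x)"
    by (metis cinner_commute cinner_scaleC_left)
  also have "\<dots> = complex_of_real ((cmod c * norm x)\<^sup>2)"
    by (simp add: cinner_self power_mult_distrib complex_norm_square mult.assoc del: of_real_power)
  finally have "(norm (c *\<^sub>C x))\<^sup>2 = (cmod c * norm x)\<^sup>2"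
    unfolding cinner_self of_real_eq_iff .
  then show ?thesis
    by (simp add: power2_eq_iff_nonneg)
qed

lemma bounded_linear_scaleC: "bounded_linear (\<lambda>x :: 'a::complex_hilbert_space. c *\<^sub>C x)"
proof (rule bounded_linear_intro[where K = "cmod c"])
  show "c *\<^sub>C (r *\<^sub>R x) = r *\<^sub>R (c *\<^sub>C x)" for r and x :: 'a
    unfolding scaleC_of_real[symmetric] scaleC_scaleC by (simp add: mult.commute)
qed (simp_all add: scaleC_add_right norm_scaleC mult.commute)


section \<open>Bounded operators\<close>

text \<open>Elements of \<^typ>\<open>'a \<Rightarrow>\<^sub>L 'a\<close> are only real-linear; the bounded operators on the complex
  Hilbert space are the complex-linear ones.\<close>

definition cops :: "('a::complex_hilbert_space \<Rightarrow>\<^sub>L 'a) set" where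
  "cops = {T. \<forall>c x. blinfun_apply T (c *\<^sub>C x) = c *\<^sub>C blinfun_apply T x}"

definition selfadjoint :: "('a::complex_hilbert_space \<Rightarrow>\<^sub>L 'a) \<Rightarrow> bool" where
  "selfadjoint T \<longleftrightarrow> T \<in> cops \<and>
     (\<forall>x y. cinner (blinfun_apply T x) y = cinner x (blinfun_apply T y))"

definition pos_semidef :: "('a::complex_hilbert_space \<Rightarrow>\<^sub>L 'a) \<Rightarrow> bool" where
  "pos_semidef T \<longleftrightarrow> selfadjoint T \<and> (\<forall>x. cinner (blinfun_apply T x) x \<in> \<real>\<^sub>\<ge>\<^sub>0)"

definition loewner_le :: "('a::complex_hilbert_space \<Rightarrow>\<^sub>L 'a) \<Rightarrow> ('a \<Rightarrow>\<^sub>L 'a) \<Rightarrow> bool"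
    (infix \<open>\<le>\<^sub>L\<close> 50) where
  "X \<le>\<^sub>L Y \<longleftrightarrow> selfadjoint X \<and> selfadjoint Y \<and> pos_semidef (Y - X)"

definition is_op_inverse :: "('a::complex_hilbert_space \<Rightarrow>\<^sub>L 'a) \<Rightarrow> ('a \<Rightarrow>\<^sub>L 'a) \<Rightarrow> bool" where
  "is_op_inverse T S \<longleftrightarrow> S \<in> cops \<and> S o\<^sub>L T = id_blinfun \<and> T o\<^sub>L S = id_blinfun"

definition op_invertible :: "('a::complex_hilbert_space \<Rightarrow>\<^sub>L 'a) \<Rightarrow> bool" where
  "op_invertible T \<longleftrightarrow> (\<exists>S. is_op_inverse T S)"

definition op_inverse :: "('a::complex_hilbert_space \<Rightarrow>\<^sub>L 'a) \<Rightarrow> ('a \<Rightarrow>\<^sub>L 'a)" where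
  "op_inverse T = (THE S. is_op_inverse T S)"

definition pos_def_ops :: "('a::complex_hilbert_space \<Rightarrow>\<^sub>L 'a) set" where
  "pos_def_ops = {T. pos_semidef T \<and> op_invertible T}"


section \<open>Continuous functional calculus of self-adjoint operators\<close>

lift_definition scalar_op :: "complex \<Rightarrow> ('a::complex_hilbert_space \<Rightarrow>\<^sub>L 'a)" is "\<lambda>c x. c *\<^sub>C x"
  by (rule bounded_linear_scaleC)

definition op_spectrum :: "('a::complex_hilbert_space \<Rightarrow>\<^sub>L 'a) \<Rightarrow> complex set" where
  "op_spectrum T = {z. \<not> op_invertible (T - scalar_op z)}"

definition op_power :: "('a::complex_hilbert_space \<Rightarrow>\<^sub>L 'a) \<Rightarrow> nat \<Rightarrow> ('a \<Rightarrow>\<^sub>L 'a)" where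
  "op_power T n = ((\<lambda>S. T o\<^sub>L S) ^^ n) id_blinfun"

definition op_poly :: "real poly \<Rightarrow> ('a::complex_hilbert_space \<Rightarrow>\<^sub>L 'a) \<Rightarrow> ('a \<Rightarrow>\<^sub>L 'a)" where
  "op_poly p T = (\<Sum>i\<le>degree p. coeff p i *\<^sub>R op_power T i)"

text \<open>For self-adjoint \<open>T\<close> (whose spectrum is a compact set of reals) and a real function \<open>f\<close> that
  is continuous on the spectrum, \<open>f(T)\<close> is the common norm limit of \<open>p\<^sub>n(T)\<close> over all sequences of
  polynomials \<open>p\<^sub>n\<close> that converge to \<open>f\<close> uniformly on the spectrum. Outside this situation the
  value is meaningless.\<close>

definition fun_calc :: "(real \<Rightarrow> real) \<Rightarrow> ('a::complex_hilbert_space \<Rightarrow>\<^sub>L 'a) \<Rightarrow> ('a \<Rightarrow>\<^sub>L 'a)" where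
  "fun_calc f T = (THE S. \<forall>p :: nat \<Rightarrow> real poly.
     uniform_limit {x. complex_of_real x \<in> op_spectrum T} (\<lambda>n. poly (p n)) f sequentially
       \<longrightarrow> (\<lambda>n. op_poly (p n) T) \<longlonglongrightarrow> S)"

definition op_powr :: "('a::complex_hilbert_space \<Rightarrow>\<^sub>L 'a) \<Rightarrow> real \<Rightarrow> ('a \<Rightarrow>\<^sub>L 'a)" where
  "op_powr T s = fun_calc (\<lambda>x. x powr s) T"


section \<open>Weighted means\<close>

definition geom_mean :: "real \<Rightarrow> ('a::complex_hilbert_space \<Rightarrow>\<^sub>L 'a) \<Rightarrow> ('a \<Rightarrow>\<^sub>L 'a) \<Rightarrow> ('a \<Rightarrow>\<^sub>L 'a)" where
  "geom_mean t A B =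
     op_powr A (1/2) o\<^sub>L op_powr (op_powr A (-1/2) o\<^sub>L B o\<^sub>L op_powr A (-1/2)) t o\<^sub>L op_powr A (1/2)"

definition spectral_geom_mean ::
    "real \<Rightarrow> ('a::complex_hilbert_space \<Rightarrow>\<^sub>L 'a) \<Rightarrow> ('a \<Rightarrow>\<^sub>L 'a) \<Rightarrow> ('a \<Rightarrow>\<^sub>L 'a)" where
  "spectral_geom_mean t A B =
     op_powr (geom_mean t (op_inverse A) B) (1/2) o\<^sub>L op_powr A (2 - 2*t)
       o\<^sub>L op_powr (geom_mean t (op_inverse A) B) (1/2)"

end

theory Submission
  imports Defs "HOL-Computational_Algebra.Fundamental_Theorem_Algebra"
begin

text \<open>
Write \<open>G = A\<^sup>-\<^sup>1 \<sharp>\<^sub>t B\<close>. The spectral geometric mean is \<open>L\<^sup>* L\<close> with \<open>L = A\<^bsup>1-t\<^esup> G\<^bsup>1/2\<^esup>\<close>, so it is bounded by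
\<open>\<gamma> = \<alpha>\<^bsup>1-t\<^esup> \<beta>\<^sup>t\<close> exactly if \<open>L L\<^sup>* = A\<^bsup>1-t\<^esup> G A\<^bsup>1-t\<^esup>\<close> is. From \<open>B \<le> \<beta>\<close> one gets
\<open>A\<^bsup>1/2\<^esup> B A\<^bsup>1/2\<^esup> \<le> \<beta> A\<close>, and since \<open>0 \<le> t \<le> 1\<close> the Loewner--Heinz inequality gives
\<open>(A\<^bsup>1/2\<^esup> B A\<^bsup>1/2\<^esup>)\<^sup>t \<le> \<beta>\<^sup>t A\<^sup>t\<close>, that is, \<open>G \<le> \<beta>\<^sup>t A\<^bsup>t-1\<^esup>\<close> (\<open>geom_mean_op_inverse_le\<close>). Hence
\<open>A\<^bsup>1-t\<^esup> G A\<^bsup>1-t\<^esup> \<le> \<beta>\<^sup>t A\<^bsup>1-t\<^esup> \<le> \<gamma>\<close>.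

The Loewner--Heinz inequality is proved by Pedersen's method: the set of exponents for which
\<open>X \<le> Y\<close> implies \<open>X\<^sup>s \<le> Y\<^sup>s\<close> is closed, contains \<open>0\<close> and \<open>1\<close>, and contains midpoints, because a
self-adjoint operator that is similar to a contraction is itself a contraction.

All of this rests on the continuous functional calculus. Its key estimate is that \<open>\<parallel>q(T)\<parallel>\<close> is at most
the supremum of \<open>\<bar>q\<bar>\<close> on the real spectrum of a self-adjoint \<open>T\<close> (\<open>norm_op_poly_le\<close>). It follows from
two facts: a real polynomial without roots in the spectrum is invertible at \<open>T\<close>, and a self-adjoint
operator whose quadratic form takes a negative value has a negative spectral value. Uniform
approximation by polynomials on an interval that contains the numerical range then gives \<open>f(T)\<close> and
its algebraic rules (\<open>fun_calc_tendsto\<close>, \<open>fun_calc_mult\<close>, \<open>fun_calc_compose\<close>).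
\<close>

section \<open>The real part of the inner product\<close>

text \<open>The real part of the inner product is a real inner product for the same norm. Over a complex space
it still sees everything: the imaginary part of the inner product of \<open>x\<close> and \<open>y\<close> is a real part with
\<open>\<i> x\<close> in place of \<open>x\<close>. So complex linear operators can be handled with real arithmetic throughout.\<close>

definition rip :: "'a::complex_hilbert_space \<Rightarrow> 'a \<Rightarrow> real" where
  "rip x y = Re (cinner x y)"

lemma rip_commute: "rip x y = rip y x"
  unfolding rip_def by (subst cinner_commute) simp

lemma rip_add_left: "rip (x + y) z = rip x z + rip y z"
  unfolding rip_def by (simp add: cinner_add_left)

lemma rip_scaleR_left: "rip (r *\<^sub>R x) y = r * rip x y"
  unfolding rip_def scaleC_of_real[symmetric] by (simp add: cinner_scaleC_left)

lemma rip_add_right: "rip z (x + y) = rip z x + rip z y"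
  using rip_add_left[of x y z] by (simp add: rip_commute)

lemma rip_scaleR_right: "rip y (r *\<^sub>R x) = r * rip y x"
  using rip_scaleR_left[of r x y] by (simp add: rip_commute)

lemma rip_minus_left: "rip (- x) y = - rip x y"
  using rip_scaleR_left[of "-1" x y] by simp

lemma rip_minus_right: "rip x (- y) = - rip x y"
  using rip_scaleR_right[of x "-1" y] by simp

lemma rip_diff_left: "rip (x - y) z = rip x z - rip y z"
  using rip_add_left[of x "- y" z] by (simp add: rip_minus_left)

lemma rip_diff_right: "rip z (x - y) = rip z x - rip z y"
  using rip_add_right[of z x "- y"] by (simp add: rip_minus_right)

lemma rip_zero_left [simp]: "rip 0 x = 0"
  using rip_scaleR_left[of 0 0 x] by simp

lemma rip_zero_right [simp]: "rip x 0 = 0"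
  using rip_scaleR_right[of x 0 0] by simp

lemmas rip_simps = rip_add_left rip_add_right rip_diff_left rip_diff_right
  rip_scaleR_left rip_scaleR_right rip_minus_left rip_minus_right

lemma rip_self: "rip x x = (norm x)\<^sup>2"
  unfolding rip_def by (simp add: cinner_self del: of_real_power)

lemma norm_diff_sq: "(norm (x - y))\<^sup>2 = (norm x)\<^sup>2 - 2 * rip x y + (norm y)\<^sup>2"
  unfolding rip_self[symmetric] by (simp add: rip_simps rip_commute)

text \<open>Expanding the square in \<open>(\<parallel>x\<parallel> - \<parallel>y\<parallel>)\<^sup>2 \<le> \<parallel>x - y\<parallel>\<^sup>2\<close> leaves exactly the Cauchy--Schwarz inequality.\<close>

lemma rip_le_norm: "rip x y \<le> norm x * norm y"
proof -
  have "\<bar>norm x - norm y\<bar> \<le> norm (x - y)"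
    by (rule norm_triangle_ineq3)
  then have "(norm x - norm y)\<^sup>2 \<le> (norm (x - y))\<^sup>2"
    by (metis abs_ge_zero power2_abs power_mono)
  then show ?thesis
    unfolding norm_diff_sq by (simp add: power2_eq_square algebra_simps)
qed

lemma rip_ge_norm: "- (norm x * norm y) \<le> rip x y"
  using rip_le_norm[of "- x" y] by (simp add: rip_minus_left)

lemma Im_cinner: "Im (cinner x y) = - rip (\<i> *\<^sub>C x) y"
  unfolding rip_def by (simp add: cinner_scaleC_left)


section \<open>Self-adjoint, positive and invertible operators\<close>

lemma copsD: "T \<in> cops \<Longrightarrow> T (c *\<^sub>C x) = c *\<^sub>C T x"
  by (simp add: cops_def)

lemma scaleC_scaleR: "c *\<^sub>C (r *\<^sub>R x) = r *\<^sub>R (c *\<^sub>C (x::'a::complex_hilbert_space))"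
  unfolding scaleC_of_real[symmetric] scaleC_scaleC by (simp add: mult.commute)

lemma scaleC_diff_right: "c *\<^sub>C (x - y) = c *\<^sub>C x - c *\<^sub>C (y::'a::complex_hilbert_space)"
  by (metis add_diff_cancel diff_add_cancel scaleC_add_right)

lemma cops_id [intro, simp]: "id_blinfun \<in> cops"
  and cops_compose [intro]: "S \<in> cops \<Longrightarrow> T \<in> cops \<Longrightarrow> S o\<^sub>L T \<in> cops"
  and cops_add [intro]: "S \<in> cops \<Longrightarrow> T \<in> cops \<Longrightarrow> S + T \<in> cops"
  and cops_diff [intro]: "S \<in> cops \<Longrightarrow> T \<in> cops \<Longrightarrow> S - T \<in> cops"
  and cops_scaleR [intro]: "S \<in> cops \<Longrightarrow> r *\<^sub>R S \<in> cops"
  by (simp_all add: cops_def blinfun.bilinear_simps scaleC_add_right scaleC_diff_right scaleC_scaleR)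

lemma selfadjoint_iff:
  "selfadjoint T \<longleftrightarrow> T \<in> cops \<and> (\<forall>x y. rip (T x) y = rip x (T y))"
proof
  assume "selfadjoint T"
  then show "T \<in> cops \<and> (\<forall>x y. rip (T x) y = rip x (T y))"
    by (simp add: selfadjoint_def rip_def)
next
  assume *: "T \<in> cops \<and> (\<forall>x y. rip (T x) y = rip x (T y))"
  then have "cinner (T x) y = cinner x (T y)" for x y
    by (intro complex_eqI) (simp_all add: Im_cinner flip: rip_def copsD)
  then show "selfadjoint T"
    using * by (simp add: selfadjoint_def)
qed

lemma selfadjoint_cops [dest]: "selfadjoint T \<Longrightarrow> T \<in> cops"
  by (simp add: selfadjoint_def)

lemma selfadjoint_rip: "selfadjoint T \<Longrightarrow> rip (T x) y = rip x (T y)"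
  by (simp add: selfadjoint_iff)

lemma pos_semidef_iff: "pos_semidef T \<longleftrightarrow> selfadjoint T \<and> (\<forall>x. 0 \<le> rip (T x) x)"
proof -
  have "Im (cinner (T x) x) = 0" if "selfadjoint T" for x
  proof -
    have "cnj (cinner (T x) x) = cinner (T x) x"
      using that by (metis cinner_commute selfadjoint_def)
    then show ?thesis by (simp add: complex_eq_iff)
  qed
  then show ?thesis
    by (auto simp: pos_semidef_def complex_nonneg_Reals_iff rip_def)
qed

lemma selfadjoint_id [simp]: "selfadjoint id_blinfun"
  by (simp add: selfadjoint_iff)

lemma selfadjoint_add: "selfadjoint S \<Longrightarrow> selfadjoint T \<Longrightarrow> selfadjoint (S + T)"
  and selfadjoint_diff: "selfadjoint S \<Longrightarrow> selfadjoint T \<Longrightarrow> selfadjoint (S - T)"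
  and selfadjoint_scaleR: "selfadjoint S \<Longrightarrow> selfadjoint (r *\<^sub>R S)"
  by (auto simp: selfadjoint_iff blinfun.bilinear_simps rip_simps)

lemma selfadjoint_congruence:
  "selfadjoint S \<Longrightarrow> selfadjoint T \<Longrightarrow> selfadjoint (S o\<^sub>L T o\<^sub>L S)"
  by (auto simp: selfadjoint_iff intro!: cops_compose)

lemma selfadjoint_zero [simp]: "selfadjoint 0"
  using selfadjoint_scaleR[OF selfadjoint_id, of 0] by simp

lemma loewner_le_iff:
  "X \<le>\<^sub>L Y \<longleftrightarrow> selfadjoint X \<and> selfadjoint Y \<and> (\<forall>x. rip (X x) x \<le> rip (Y x) x)"
  by (auto simp: loewner_le_def pos_semidef_iff selfadjoint_diff blinfun.bilinear_simps rip_simps)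

lemma op_inverse_unique:
  assumes "is_op_inverse T S" "is_op_inverse T S'"
  shows "S = S'"
proof -
  have "S x = S' x" for x
  proof -
    have "S (T (S' x)) = S' x" "T (S' x) = x"
      using assms by (metis blinfun_apply_blinfun_compose blinfun_apply_id_blinfun is_op_inverse_def id_apply)+
    then show ?thesis by simp
  qed
  then show ?thesis by (rule blinfun_eqI)
qed

lemma op_inverse_eqI: "is_op_inverse T S \<Longrightarrow> op_inverse T = S"
  unfolding op_inverse_def by (blast intro: op_inverse_unique)

lemma op_invertible_compose:
  assumes "op_invertible S" "op_invertible T"
  shows "op_invertible (S o\<^sub>L T)"
proof -
  obtain S' T' where "is_op_inverse S S'" "is_op_inverse T T'"
    using assms by (auto simp: op_invertible_def)
  then have "is_op_inverse (S o\<^sub>L T) (T' o\<^sub>L S')"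
    unfolding is_op_inverse_def
    by (auto intro!: blinfun_eqI) (metis blinfun_apply_blinfun_compose blinfun_apply_id_blinfun id_apply)+
  then show ?thesis by (auto simp: op_invertible_def)
qed

text \<open>The Lax--Milgram argument: \<open>P x = y\<close> says that \<open>x\<close> is a fixed point of \<open>x \<mapsto> x - s (P x - y)\<close>, and
coercivity makes this map a contraction when \<open>s > 0\<close> is small.\<close>

lemma op_invertible_of_coercive:
  fixes P :: "'a::complex_hilbert_space \<Rightarrow>\<^sub>L 'a"
  assumes P: "P \<in> cops" and c: "c > 0" and coer: "\<And>x. c * (norm x)\<^sup>2 \<le> rip (P x) x"
  shows "op_invertible P"
proof -
  have low: "c * norm x \<le> norm (P x)" for x
  proof (cases "x = 0")
    case False
    have "c * norm x * norm x \<le> norm (P x) * norm x"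
      using coer[of x] rip_le_norm[of "P x" x] by (simp add: power2_eq_square)
    then show ?thesis using False by simp
  qed simp
  define N where "N = norm P + c"
  have N: "N > 0" "c \<le> N" "norm P \<le> N" using c by (simp_all add: N_def add_nonneg_pos)
  \<comment> \<open>This \<open>s\<close> minimises \<open>1 - 2 s c + s\<^sup>2 N\<^sup>2\<close>, a bound for the squared contraction factor;
    \<open>q\<close> is the minimum.\<close>
  define s where "s = c / N\<^sup>2"
  have s: "s > 0" using c N by (simp add: s_def)
  define q where "q = 1 - c\<^sup>2 / N\<^sup>2"
  have q: "0 \<le> q" "q < 1"
    using c N by (auto simp: q_def divide_simps power_mono)
  have contr: "(norm (x - s *\<^sub>R P x))\<^sup>2 \<le> q * (norm x)\<^sup>2" for x
  proof -
    have "norm (P x) \<le> N * norm x"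
      using norm_blinfun[of P x] N by (meson mult_right_mono norm_ge_zero order_trans)
    then have "(norm (P x))\<^sup>2 \<le> N\<^sup>2 * (norm x)\<^sup>2"
      by (metis norm_ge_zero power_mono power_mult_distrib)
    then have "s\<^sup>2 * (norm (P x))\<^sup>2 \<le> s\<^sup>2 * (N\<^sup>2 * (norm x)\<^sup>2)"
      by (intro mult_left_mono) auto
    moreover have "s * (c * (norm x)\<^sup>2) \<le> s * rip (P x) x"
      using coer s by (intro mult_left_mono) auto
    ultimately have "(norm (x - s *\<^sub>R P x))\<^sup>2
        \<le> (norm x)\<^sup>2 - 2 * (s * (c * (norm x)\<^sup>2)) + s\<^sup>2 * (N\<^sup>2 * (norm x)\<^sup>2)"
      unfolding norm_diff_sq by (simp add: rip_simps rip_commute power_mult_distrib)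
    also have "\<dots> = q * (norm x)\<^sup>2"
      using N by (simp add: s_def q_def field_simps power2_eq_square)
    finally show ?thesis .
  qed
  have surj: "\<exists>x. P x = y" for y
  proof -
    have "\<exists>!x. x - s *\<^sub>R (P x - y) = x"
    proof (rule banach_fix_type[where c = "sqrt q"])
      show "\<forall>x x'. dist (x - s *\<^sub>R (P x - y)) (x' - s *\<^sub>R (P x' - y)) \<le> sqrt q * dist x x'"
      proof (intro allI)
        fix x x'
        have "dist (x - s *\<^sub>R (P x - y)) (x' - s *\<^sub>R (P x' - y)) = norm ((x - x') - s *\<^sub>R P (x - x'))"
          by (simp add: dist_norm blinfun.bilinear_simps algebra_simps)
        also have "\<dots> \<le> sqrt (q * (norm (x - x'))\<^sup>2)"
          using contr by (simp add: real_le_rsqrt)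
        finally show "dist (x - s *\<^sub>R (P x - y)) (x' - s *\<^sub>R (P x' - y)) \<le> sqrt q * dist x x'"
          by (simp add: real_sqrt_mult dist_norm)
      qed
    qed (use q in auto)
    then obtain x where "x - s *\<^sub>R (P x - y) = x" by blast
    then have "s *\<^sub>R (P x - y) = 0"
      by (metis cancel_comm_monoid_add_class.diff_cancel diff_diff_eq2 add_diff_cancel_left')
    then show ?thesis using s by auto
  qed
  have inj: "x = x'" if "P x = P x'" for x x'
  proof -
    have "c * norm (x - x') \<le> 0"
      using low[of "x - x'"] that by (simp add: blinfun.bilinear_simps)
    then show ?thesis using c by (simp add: mult_le_0_iff)
  qed
  define R where "R y = (SOME x. P x = y)" for y
  have PR: "P (R y) = y" for y
    unfolding R_def by (rule someI_ex[OF surj])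
  have "bounded_linear R"
  proof (rule bounded_linear_intro[where K = "1 / c"])
    show "norm (R x) \<le> norm x * (1 / c)" for x
      using low[of "R x"] c by (simp add: PR field_simps)
  qed (rule inj, simp add: PR blinfun.bilinear_simps)+
  then have R: "blinfun_apply (Blinfun R) = R" by (rule bounded_linear_Blinfun_apply)
  have "Blinfun R \<in> cops"
    unfolding cops_def by (auto simp: R) (rule inj, simp add: PR copsD[OF P])
  moreover have "R (P x) = x" for x
    by (rule inj) (simp add: PR)
  ultimately have "is_op_inverse P (Blinfun R)"
    unfolding is_op_inverse_def by (auto intro!: blinfun_eqI simp: R PR)
  then show ?thesis by (auto simp: op_invertible_def)
qed

text \<open>Positivity at the one vector \<open>x - P x / N\<close> with \<open>N = \<parallel>P\<parallel> + 1\<close> gives the bound; the summand \<open>1\<close>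
keeps \<open>N\<close> away from zero.\<close>

lemma norm_sq_le_quadratic_form:
  assumes "pos_semidef P"
  shows "(norm (P x))\<^sup>2 \<le> (norm P + 1) * rip (P x) x"
proof -
  define N where "N = norm P + 1"
  have N: "N > 0" "norm P \<le> N" unfolding N_def by (simp_all add: add_nonneg_pos)
  have sa: "selfadjoint P" and pos: "0 \<le> rip (P y) y" for y
    using assms by (auto simp: pos_semidef_iff)
  have "rip (P (P x)) (P x) \<le> norm P * norm (P x) * norm (P x)"
    by (meson norm_blinfun rip_le_norm mult_right_mono norm_ge_zero order_trans)
  also have "\<dots> \<le> N * (norm (P x))\<^sup>2"
    using N by (simp add: power2_eq_square mult_right_mono mult.assoc)
  finally have 1: "rip (P (P x)) (P x) / N\<^sup>2 \<le> (norm (P x))\<^sup>2 / N"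
    using N by (simp add: field_simps power2_eq_square)
  have "0 \<le> rip (P (x - (1/N) *\<^sub>R P x)) (x - (1/N) *\<^sub>R P x)" by (rule pos)
  also have "\<dots> = rip (P x) x - 2 * (norm (P x))\<^sup>2 / N + rip (P (P x)) (P x) / N\<^sup>2"
    using N selfadjoint_rip[OF sa, of "P x" x]
    by (simp add: blinfun.bilinear_simps rip_simps rip_self power2_eq_square field_simps rip_commute)
  finally have "(norm (P x))\<^sup>2 / N \<le> rip (P x) x" using 1 by simp
  then show ?thesis using N by (simp add: N_def field_simps)
qed

text \<open>Invertibility gives \<open>\<parallel>x\<parallel> \<le> K \<parallel>P x\<parallel>\<close>, and for positive \<open>P\<close> the norm of \<open>P x\<close> is controlled by the
quadratic form. Together with the Lax--Milgram criterion, the positive definite operators are exactly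
the coercive self-adjoint ones.\<close>

lemma coercive_of_pos_invertible:
  fixes P :: "'a::complex_hilbert_space \<Rightarrow>\<^sub>L 'a"
  assumes P: "pos_semidef P" and inv: "op_invertible P"
  shows "\<exists>c>0. \<forall>x. c * (norm x)\<^sup>2 \<le> rip (P x) x"
proof -
  obtain S where S: "is_op_inverse P S" using inv by (auto simp: op_invertible_def)
  have SP: "S (P x) = x" for x
    using S by (metis blinfun_apply_blinfun_compose blinfun_apply_id_blinfun is_op_inverse_def id_apply)
  define K where "K = norm S + 1"
  define N where "N = norm P + 1"
  have K: "K > 0" "norm S \<le> K" and N: "N > 0"
    by (simp_all add: K_def N_def add_nonneg_pos)
  have "1 / (K\<^sup>2 * N) * (norm x)\<^sup>2 \<le> rip (P x) x" for x
  proof -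
    have "norm x \<le> K * norm (P x)"
      using norm_blinfun[of S "P x"] K unfolding SP
      by (meson mult_right_mono norm_ge_zero order_trans)
    then have "(norm x)\<^sup>2 \<le> K\<^sup>2 * (norm (P x))\<^sup>2"
      by (metis norm_ge_zero power_mono power_mult_distrib)
    also have "\<dots> \<le> K\<^sup>2 * (N * rip (P x) x)"
      using norm_sq_le_quadratic_form[OF P, of x] by (simp add: N_def mult_left_mono)
    finally show ?thesis using K N by (simp add: field_simps)
  qed
  moreover have "1 / (K\<^sup>2 * N) > 0" using K N by simp
  ultimately show ?thesis by blast
qed

lemma pos_def_ops_iff:
  "P \<in> pos_def_ops \<longleftrightarrow> selfadjoint P \<and> (\<exists>c>0. \<forall>x. c * (norm x)\<^sup>2 \<le> rip (P x) x)"
proof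
  assume "P \<in> pos_def_ops"
  then show "selfadjoint P \<and> (\<exists>c>0. \<forall>x. c * (norm x)\<^sup>2 \<le> rip (P x) x)"
    using coercive_of_pos_invertible[of P] by (auto simp: pos_def_ops_def pos_semidef_iff)
next
  assume "selfadjoint P \<and> (\<exists>c>0. \<forall>x. c * (norm x)\<^sup>2 \<le> rip (P x) x)"
  then obtain c where sa: "selfadjoint P" and c: "c > 0" "\<And>x. c * (norm x)\<^sup>2 \<le> rip (P x) x"
    by auto
  have "0 \<le> rip (P x) x" for x
    using c(2)[of x] c(1) by (meson mult_nonneg_nonneg zero_le_power2 less_imp_le order_trans)
  then show "P \<in> pos_def_ops"
    using sa c op_invertible_of_coercive[of P c]
    by (auto simp: pos_def_ops_def pos_semidef_iff)
qed


section \<open>Polynomials of an operator\<close>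

lemma op_power_0 [simp]: "op_power T 0 = id_blinfun"
  and op_power_Suc [simp]: "op_power T (Suc n) = T o\<^sub>L op_power T n"
  by (simp_all add: op_power_def)

lemma op_poly_eq_sum:
  assumes "degree p \<le> n"
  shows "op_poly p T = (\<Sum>i\<le>n. coeff p i *\<^sub>R op_power T i)"
  unfolding op_poly_def
  by (rule sum.mono_neutral_left) (use assms in \<open>auto simp: coeff_eq_0\<close>)

lemma op_poly_0 [simp]: "op_poly 0 T = 0"
  by (simp add: op_poly_def)

lemma op_poly_pCons: "op_poly (pCons a p) T = a *\<^sub>R id_blinfun + (T o\<^sub>L op_poly p T)"
proof -
  have "op_poly (pCons a p) T
      = a *\<^sub>R id_blinfun + (\<Sum>i\<le>degree p. coeff p i *\<^sub>R (T o\<^sub>L op_power T i))"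
    unfolding op_poly_eq_sum[OF degree_pCons_le] by (simp add: sum.atMost_Suc_shift del: sum.atMost_Suc)
  also have "\<dots> = a *\<^sub>R id_blinfun + (T o\<^sub>L op_poly p T)"
    unfolding op_poly_def
    by (intro blinfun_eqI) (simp add: blinfun.bilinear_simps blinfun.sum_left blinfun.sum_right)
  finally show ?thesis .
qed

lemma op_poly_const: "op_poly [:a:] T = a *\<^sub>R id_blinfun"
  by (simp add: op_poly_pCons)

lemma op_poly_X: "op_poly [:0, 1:] T = T"
  by (simp add: op_poly_pCons) (intro blinfun_eqI, simp)

lemma op_poly_add: "op_poly (p + q) T = op_poly p T + op_poly q T"
proof -
  let ?n = "max (degree p) (degree q)"
  have "degree (p + q) \<le> ?n" by (rule degree_add_le_max)
  then show ?thesis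
    by (simp add: op_poly_eq_sum[of _ ?n] sum.distrib scaleR_add_left)
qed

lemma op_poly_smult: "op_poly (smult a p) T = a *\<^sub>R op_poly p T"
  using op_poly_eq_sum[OF degree_smult_le, of a p T]
  by (simp add: op_poly_def scaleR_sum_right)

lemma op_poly_diff: "op_poly (p - q) T = op_poly p T - op_poly q T"
  using op_poly_add[of p "smult (-1) q" T] op_poly_smult[of "-1" q T] by simp

lemma op_poly_mult: "op_poly (p * q) T = op_poly p T o\<^sub>L op_poly q T"
proof (induction p)
  case (pCons a p)
  then show ?case
    by (intro blinfun_eqI)
      (simp add: op_poly_add op_poly_smult op_poly_pCons blinfun.bilinear_simps)
qed simp

lemma op_poly_selfadjoint:
  assumes T: "selfadjoint T"
  shows "selfadjoint (op_poly p T)"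
proof (induction p)
  case (pCons a p)
  have comm: "T (op_poly p T x) = op_poly p T (T x)" for x
    using op_poly_mult[of "[:0, 1:]" p T] op_poly_mult[of p "[:0, 1:]" T]
    unfolding op_poly_X mult.commute[of p] by (metis blinfun_apply_blinfun_compose)
  have "selfadjoint (T o\<^sub>L op_poly p T)"
    unfolding selfadjoint_iff
    using T pCons(2) by (auto simp: selfadjoint_rip comm)
  then show ?case
    unfolding op_poly_pCons by (intro selfadjoint_add selfadjoint_scaleR) simp_all
qed simp


section \<open>Spectral bound for polynomials of a self-adjoint operator\<close>

definition real_spectrum :: "('a::complex_hilbert_space \<Rightarrow>\<^sub>L 'a) \<Rightarrow> real set" where
  "real_spectrum T = {x. \<not> op_invertible (T - x *\<^sub>R id_blinfun)}"

lemma real_spectrum_eq: "{x. complex_of_real x \<in> op_spectrum T} = real_spectrum T"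
proof -
  have "scalar_op (complex_of_real x) = (x *\<^sub>R id_blinfun :: 'a \<Rightarrow>\<^sub>L 'a)" for x
    by (intro blinfun_eqI) (simp add: scalar_op.rep_eq scaleC_of_real blinfun.bilinear_simps)
  then show ?thesis by (simp add: op_spectrum_def real_spectrum_def)
qed

lemma op_invertible_scaled_id: "r \<noteq> 0 \<Longrightarrow> op_invertible (r *\<^sub>R id_blinfun)"
  unfolding op_invertible_def is_op_inverse_def
  by (intro exI[of _ "(1 / r) *\<^sub>R id_blinfun"])
    (auto intro!: blinfun_eqI simp: blinfun.bilinear_simps)

definition cpoly :: "real poly \<Rightarrow> complex \<Rightarrow> complex" where
  "cpoly p z = poly (map_poly complex_of_real p) z"

lemma cpoly_0 [simp]: "cpoly 0 z = 0"
  and cpoly_pCons [simp]: "cpoly (pCons a p) z = complex_of_real a + z * cpoly p z"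
  by (simp_all add: cpoly_def map_poly_pCons)

lemma cpoly_add: "cpoly (p + q) z = cpoly p z + cpoly q z"
  by (induction p q rule: poly_induct2) (simp_all add: algebra_simps)

lemma cpoly_smult: "cpoly (smult a p) z = complex_of_real a * cpoly p z"
  by (induction p) (simp_all add: algebra_simps)

lemma cpoly_mult: "cpoly (p * q) z = cpoly p z * cpoly q z"
  by (induction p) (simp_all add: cpoly_add cpoly_smult algebra_simps)

lemma cpoly_of_real: "cpoly p (complex_of_real x) = complex_of_real (poly p x)"
  by (induction p) simp_all

text \<open>The remainder of \<open>p\<close> modulo this quadratic is linear with real coefficients and vanishes at the
non-real point \<open>z\<close>, so it is zero.\<close>

lemma real_quadratic_factor:
  assumes root: "cpoly p z = 0" and im: "Im z \<noteq> 0"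
  shows "[:(Re z)\<^sup>2 + (Im z)\<^sup>2, - 2 * Re z, 1:] dvd p"
proof -
  define d where "d = [:(Re z)\<^sup>2 + (Im z)\<^sup>2, - 2 * Re z, 1:]"
  have d0: "cpoly d z = 0"
    by (simp add: d_def complex_eq_iff power2_eq_square algebra_simps)
  have "degree (p mod d) < 2"
    using degree_mod_less[of d p] by (cases "p mod d = 0") (auto simp: d_def)
  then obtain v u where r: "p mod d = [:v, u:]"
    by (metis pCons_cases degree_pCons_eq_if degree_eq_zeroE less_2_cases One_nat_def Suc_inject
        nat.distinct(1) pCons_0_0)
  have "p = p div d * d + p mod d" by simp
  then have "cpoly (p mod d) z = 0"
    using root d0 by (metis cpoly_add cpoly_mult add_0 mult_zero_right)
  then have "u = 0" "v = 0"
    using im by (auto simp: r complex_eq_iff)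
  then have "p mod d = 0" by (simp add: r)
  then show ?thesis by (simp add: d_def mod_eq_0_iff_dvd)
qed

text \<open>The spectral mapping theorem in the form that is needed. Split off a factor at a complex root. A real
root is not a spectral value, so its linear factor is invertible at \<open>T\<close>. A non-real root \<open>a + b \<i>\<close>
contributes \<open>(T - a)\<^sup>2 + b\<^sup>2\<close>, which is coercive because \<open>T\<close> is self-adjoint.\<close>

lemma op_poly_invertible:
  fixes T :: "'a::complex_hilbert_space \<Rightarrow>\<^sub>L 'a"
  assumes T: "selfadjoint T"
  shows "p \<noteq> 0 \<Longrightarrow> (\<And>x. x \<in> real_spectrum T \<Longrightarrow> poly p x \<noteq> 0) \<Longrightarrow> op_invertible (op_poly p T)"
proof (induction "degree p" arbitrary: p rule: less_induct)
  case less
  show ?case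
  proof (cases "degree p = 0")
    case True
    then obtain a where "p = [:a:]" by (rule degree_eq_zeroE)
    then show ?thesis
      using less.prems by (simp add: op_poly_const op_invertible_scaled_id)
  next
    case False
    have step: ?thesis if d: "d dvd p" "degree d > 0" "op_invertible (op_poly d T)" for d
    proof -
      obtain r where r: "p = d * r" using d by (auto elim: dvdE)
      have nz: "d \<noteq> 0" "r \<noteq> 0" using less.prems r by auto
      then have "degree r < degree p" using r d by (simp add: degree_mult_eq)
      then have "op_invertible (op_poly r T)"
        using less.hyps[of r] less.prems(2) nz r by auto
      then show ?thesis
        unfolding r op_poly_mult by (rule op_invertible_compose[OF d(3)])
    qed
    have "degree (map_poly complex_of_real p) \<noteq> 0"
      using False by (simp add: degree_map_poly)
    then obtain z where z: "cpoly p z = 0"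
      using fundamental_theorem_of_algebra constant_degree cpoly_def by metis
    show ?thesis
    proof (cases "Im z = 0")
      case True
      define x where "x = Re z"
      have "z = complex_of_real x" using True by (simp add: x_def complex_eq_iff)
      then have root: "poly p x = 0" using z by (simp add: cpoly_of_real)
      then have "op_invertible (T - x *\<^sub>R id_blinfun)"
        using less.prems(2)[of x] by (auto simp: real_spectrum_def)
      moreover have "op_poly [:- x, 1:] T = T - x *\<^sub>R id_blinfun"
        by (intro blinfun_eqI) (simp add: op_poly_pCons blinfun.bilinear_simps)
      ultimately show ?thesis
        using root by (intro step[of "[:- x, 1:]"]) (auto simp: poly_eq_0_iff_dvd)
    next
      case False
      define a b where "a = Re z" and "b = Im z"
      define d where "d = [:a\<^sup>2 + b\<^sup>2, - 2 * a, 1:]"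
      have "d dvd p"
        unfolding d_def a_def b_def by (rule real_quadratic_factor[OF z False])
      moreover have "op_invertible (op_poly d T)"
      proof (rule op_invertible_of_coercive)
        show "op_poly d T \<in> cops" using op_poly_selfadjoint[OF T] by blast
        show "b\<^sup>2 > 0" using False by (simp add: b_def)
        show "b\<^sup>2 * (norm x)\<^sup>2 \<le> rip (op_poly d T x) x" for x
        proof -
          have "(norm (T x - a *\<^sub>R x))\<^sup>2
              = (norm (T x))\<^sup>2 - 2 * a * rip (T x) x + a\<^sup>2 * (norm x)\<^sup>2"
            by (simp add: norm_diff_sq rip_simps power_mult_distrib)
          then have "rip (op_poly d T x) x = (norm (T x - a *\<^sub>R x))\<^sup>2 + b\<^sup>2 * (norm x)\<^sup>2"
            using selfadjoint_rip[OF T, of "T x" x]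
            by (simp add: d_def op_poly_pCons blinfun.bilinear_simps rip_simps rip_self
                algebra_simps)
          then show ?thesis by simp
        qed
      qed
      ultimately show ?thesis by (intro step[of d]) (auto simp: d_def)
    qed
  qed
qed

text \<open>The spectral value is the infimum \<open>m\<close> of the Rayleigh quotient. The operator \<open>S - m\<close> is positive; if
it were invertible it would be coercive, and \<open>m\<close> could be increased.\<close>

lemma negative_spectral_value:
  fixes S :: "'a::complex_hilbert_space \<Rightarrow>\<^sub>L 'a"
  assumes S: "selfadjoint S" and neg: "rip (S y) y < 0"
  obtains m where "m < 0" "m \<in> real_spectrum S"
proof -
  define Q where "Q = {rip (S x) x / (norm x)\<^sup>2 | x. x \<noteq> 0}"
  have y: "y \<noteq> 0" using neg by auto
  have yQ: "rip (S y) y / (norm y)\<^sup>2 \<in> Q" using y by (auto simp: Q_def)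
  have bdd: "bdd_below Q"
  proof (rule bdd_belowI)
    fix r assume "r \<in> Q"
    then obtain x where x: "x \<noteq> 0" "r = rip (S x) x / (norm x)\<^sup>2" by (auto simp: Q_def)
    have "- (norm S * norm x * norm x) \<le> rip (S x) x"
      using rip_ge_norm[of "S x" x] norm_blinfun[of S x]
      by (smt (verit) mult_right_mono norm_ge_zero)
    then have "- norm S * (norm x)\<^sup>2 \<le> rip (S x) x"
      by (simp add: power2_eq_square ac_simps)
    then show "- norm S \<le> r" using x by (simp add: pos_le_divide_eq)
  qed
  define m where "m = Inf Q"
  have "m \<le> rip (S y) y / (norm y)\<^sup>2"
    unfolding m_def by (rule cInf_lower[OF yQ bdd])
  also have "\<dots> < 0" using neg y by (simp add: divide_neg_pos)
  finally have m: "m < 0" .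
  have low: "m * (norm x)\<^sup>2 \<le> rip (S x) x" for x
  proof (cases "x = 0")
    case False
    then have "m \<le> rip (S x) x / (norm x)\<^sup>2"
      unfolding m_def by (intro cInf_lower bdd) (auto simp: Q_def)
    then show ?thesis using False by (simp add: field_simps)
  qed simp
  have "\<not> op_invertible (S - m *\<^sub>R id_blinfun)"
  proof
    assume inv: "op_invertible (S - m *\<^sub>R id_blinfun)"
    have "pos_semidef (S - m *\<^sub>R id_blinfun)"
      using low S by (simp add: pos_semidef_iff selfadjoint_diff selfadjoint_scaleR
          blinfun.bilinear_simps rip_simps rip_self)
    from coercive_of_pos_invertible[OF this inv] obtain c where
      c: "c > 0" "\<And>x. c * (norm x)\<^sup>2 \<le> rip (S x) x - m * (norm x)\<^sup>2"
      by (auto simp: blinfun.bilinear_simps rip_simps rip_self)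
    have "m + c \<le> m"
      unfolding m_def
    proof (rule cInf_greatest, unfold m_def[symmetric])
      show "Q \<noteq> {}" using yQ by auto
      fix r assume "r \<in> Q"
      then obtain x where x: "x \<noteq> 0" "r = rip (S x) x / (norm x)\<^sup>2" by (auto simp: Q_def)
      then show "m + c \<le> r" using c(2)[of x] by (simp add: pos_le_divide_eq algebra_simps)
    qed
    then show False using c by simp
  qed
  then show ?thesis using m that by (simp add: real_spectrum_def)
qed

text \<open>Shifting \<open>T\<close> by more than its norm makes the quadratic form negative somewhere.\<close>

lemma real_spectrum_nonempty:
  fixes T :: "'a::complex_hilbert_space \<Rightarrow>\<^sub>L 'a"
  assumes T: "selfadjoint T" and y: "(y :: 'a) \<noteq> 0"
  shows "real_spectrum T \<noteq> {}"
proof -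
  define N where "N = norm T + 1"
  have "rip (T y) y \<le> norm T * norm y * norm y"
    by (meson norm_blinfun rip_le_norm mult_right_mono norm_ge_zero order_trans)
  then have "rip ((T - N *\<^sub>R id_blinfun) y) y < 0"
    using y by (simp add: N_def blinfun.bilinear_simps rip_simps rip_self power2_eq_square algebra_simps)
      (smt (verit) zero_less_mult_iff zero_less_norm_iff)
  then obtain m where "m \<in> real_spectrum (T - N *\<^sub>R id_blinfun)"
    using negative_spectral_value[of "T - N *\<^sub>R id_blinfun" y]
      selfadjoint_diff[OF T selfadjoint_scaleR[OF selfadjoint_id]] by metis
  then have "N + m \<in> real_spectrum T"
    by (simp add: real_spectrum_def scaleR_add_left diff_diff_eq)
  then show ?thesis by auto
qed

text \<open>A negative value of the quadratic form of \<open>q(T)\<close> yields a spectral value \<open>m < 0\<close> of \<open>q(T)\<close>, and then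
\<open>q - m\<close> must have a root in the spectrum of \<open>T\<close>.\<close>

lemma op_poly_nonneg:
  assumes T: "selfadjoint T" and q: "\<And>x. x \<in> real_spectrum T \<Longrightarrow> 0 \<le> poly q x"
  shows "0 \<le> rip (op_poly q T y) y"
proof (rule ccontr)
  assume "\<not> ?thesis"
  then have neg: "rip (op_poly q T y) y < 0" by simp
  then have y: "y \<noteq> 0" by auto
  obtain m where m: "m < 0" "m \<in> real_spectrum (op_poly q T)"
    using negative_spectral_value[OF op_poly_selfadjoint[OF T] neg] by blast
  have ninv: "\<not> op_invertible (op_poly (q - [:m:]) T)"
    using m by (simp add: real_spectrum_def op_poly_diff op_poly_const)
  obtain x where "x \<in> real_spectrum T" "poly (q - [:m:]) x = 0"
    \<comment> \<open>For constant \<open>q = m\<close> the contradiction needs a point at which to evaluate \<open>q\<close>.\<close>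
  proof (cases "q - [:m:] = 0")
    case True
    then show ?thesis using that real_spectrum_nonempty[OF T y] by force
  next
    case False
    then show ?thesis using that op_poly_invertible[OF T False] ninv by blast
  qed
  then show False using q[of x] m by simp
qed

text \<open>Apply positivity to the polynomial \<open>e\<^sup>2 - q\<^sup>2\<close>.\<close>

lemma norm_op_poly_le:
  assumes T: "selfadjoint T" and e: "e \<ge> 0"
    and q: "\<And>x. x \<in> real_spectrum T \<Longrightarrow> \<bar>poly q x\<bar> \<le> e"
  shows "norm (op_poly q T) \<le> e"
proof (rule norm_blinfun_bound[OF e])
  fix y
  have "(poly q x)\<^sup>2 \<le> e\<^sup>2" if "x \<in> real_spectrum T" for x
    using q[OF that] e by (simp flip: abs_le_square_iff)
  then have "0 \<le> rip (op_poly ([:e\<^sup>2:] - q * q) T y) y"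
    by (intro op_poly_nonneg[OF T]) (simp add: power2_eq_square)
  also have "\<dots> = (e * norm y)\<^sup>2 - (norm (op_poly q T y))\<^sup>2"
    using selfadjoint_rip[OF op_poly_selfadjoint[OF T], of q "op_poly q T y" y]
    by (simp add: op_poly_diff op_poly_const op_poly_mult blinfun.bilinear_simps rip_simps rip_self
        power_mult_distrib)
  finally have "(norm (op_poly q T y))\<^sup>2 \<le> (e * norm y)\<^sup>2" by simp
  then show "norm (op_poly q T y) \<le> e * norm y"
    by (rule power2_le_imp_le) (use e in simp)
qed


section \<open>Continuous functional calculus\<close>

text \<open>An interval that contains the numerical range, hence the spectrum. It replaces the spectrum as the
set on which functions are approximated: it is compact without further proof, and it is easy to bound
for an operator \<open>f(T)\<close>, which composition of functions needs.\<close>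

definition op_between :: "real \<Rightarrow> ('a::complex_hilbert_space \<Rightarrow>\<^sub>L 'a) \<Rightarrow> real \<Rightarrow> bool" where
  "op_between c T M \<longleftrightarrow> selfadjoint T \<and>
     (\<forall>x. c * (norm x)\<^sup>2 \<le> rip (T x) x \<and> rip (T x) x \<le> M * (norm x)\<^sup>2)"

lemma op_between_selfadjoint: "op_between c T M \<Longrightarrow> selfadjoint T"
  by (simp add: op_between_def)

lemma real_spectrum_subset:
  assumes T: "op_between c T M"
  shows "real_spectrum T \<subseteq> {c..M}"
proof (rule subsetI, rule ccontr)
  fix r assume r: "r \<in> real_spectrum T" "r \<notin> {c..M}"
  have sa: "selfadjoint T" using T by (rule op_between_selfadjoint)
  then have cops: "T - r *\<^sub>R id_blinfun \<in> cops" "r *\<^sub>R id_blinfun - T \<in> cops" by auto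
  have "op_invertible (T - r *\<^sub>R id_blinfun)"
  proof (cases "r < c")
    case True
    show ?thesis
    proof (rule op_invertible_of_coercive[OF cops(1)])
      show "c - r > 0" using True by simp
      show "(c - r) * (norm x)\<^sup>2 \<le> rip ((T - r *\<^sub>R id_blinfun) x) x" for x
        using T by (simp add: op_between_def blinfun.bilinear_simps rip_simps rip_self left_diff_distrib)
    qed
  next
    case False
    have "op_invertible (r *\<^sub>R id_blinfun - T)"
    proof (rule op_invertible_of_coercive[OF cops(2)])
      show "r - M > 0" using False r by simp
      show "(r - M) * (norm x)\<^sup>2 \<le> rip ((r *\<^sub>R id_blinfun - T) x) x" for x
        using T by (simp add: op_between_def blinfun.bilinear_simps rip_simps rip_self left_diff_distrib)
    qed
    then have "op_invertible (((-1) *\<^sub>R id_blinfun) o\<^sub>L (r *\<^sub>R id_blinfun - T))"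
      by (intro op_invertible_compose op_invertible_scaled_id) simp_all
    moreover have "((-1) *\<^sub>R id_blinfun) o\<^sub>L (r *\<^sub>R id_blinfun - T) = T - r *\<^sub>R id_blinfun"
      by (intro blinfun_eqI) (simp add: blinfun.bilinear_simps)
    ultimately show ?thesis by simp
  qed
  then show False using r by (simp add: real_spectrum_def)
qed

lemma real_polynomial_function_imp_poly:
  assumes "real_polynomial_function g"
  obtains p where "\<And>x. poly p x = g x"
proof -
  obtain a n where g: "g = (\<lambda>x. \<Sum>i\<le>n. a i * x ^ i)"
    using assms by (auto simp: real_polynomial_function_iff_sum)
  have "poly (\<Sum>i\<le>n. monom (a i) i) x = g x" for x
    by (simp add: g poly_sum poly_monom)
  then show ?thesis by (rule that)
qed

lemma Weierstrass_poly_sequence: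
  fixes f :: "real \<Rightarrow> real"
  assumes f: "continuous_on {c..M} f"
  obtains p :: "nat \<Rightarrow> real poly" where "uniform_limit {c..M} (\<lambda>n. poly (p n)) f sequentially"
proof -
  have "\<exists>p. \<forall>x\<in>{c..M}. \<bar>f x - poly p x\<bar> < 1 / Suc n" for n
  proof -
    obtain g where g: "real_polynomial_function g" "\<And>x. x \<in> {c..M} \<Longrightarrow> \<bar>f x - g x\<bar> < 1 / Suc n"
      using Stone_Weierstrass_real_polynomial_function[OF compact_Icc f, of "1 / Suc n"] by auto
    then show ?thesis
      by (metis real_polynomial_function_imp_poly)
  qed
  then obtain p where p: "\<And>n x. x \<in> {c..M} \<Longrightarrow> \<bar>f x - poly (p n) x\<bar> < 1 / Suc n" by metis
  have "uniform_limit {c..M} (\<lambda>n. poly (p n)) f sequentially"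
  proof (rule uniform_limitI)
    fix e :: real assume "e > 0"
    then have "\<forall>\<^sub>F n in sequentially. 1 / Suc n < e"
      using order_tendstoD(2)[OF LIMSEQ_inverse_real_of_nat] by (simp add: inverse_eq_divide)
    then show "\<forall>\<^sub>F n in sequentially. \<forall>x\<in>{c..M}. dist (poly (p n) x) (f x) < e"
    proof eventually_elim
      case (elim n)
      then show ?case
        using p[of _ n] by (metis abs_minus_commute dist_real_def order_less_trans)
    qed
  qed
  then show ?thesis by (rule that)
qed

lemma op_poly_diff_tendsto_0:
  assumes T: "selfadjoint T"
    and p: "uniform_limit (real_spectrum T) (\<lambda>n. poly (p n)) f sequentially"
    and q: "uniform_limit (real_spectrum T) (\<lambda>n. poly (q n)) f sequentially"
  shows "(\<lambda>n. op_poly (p n) T - op_poly (q n) T) \<longlonglongrightarrow> 0"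
proof (rule tendstoI)
  fix e :: real assume e: "e > 0"
  then have "e / 4 > 0" by simp
  then have "\<forall>\<^sub>F n in sequentially. \<forall>x\<in>real_spectrum T. dist (poly (p n) x) (f x) < e / 4"
    "\<forall>\<^sub>F n in sequentially. \<forall>x\<in>real_spectrum T. dist (poly (q n) x) (f x) < e / 4"
    using uniform_limitD[OF p] uniform_limitD[OF q] by blast+
  then show "\<forall>\<^sub>F n in sequentially. dist (op_poly (p n) T - op_poly (q n) T) 0 < e"
  proof eventually_elim
    case (elim n)
    have "norm (op_poly (p n - q n) T) \<le> e / 2"
    proof (rule norm_op_poly_le[OF T])
      show "\<bar>poly (p n - q n) x\<bar> \<le> e / 2" if "x \<in> real_spectrum T" for x
        using elim[THEN bspec, OF that] unfolding dist_real_def poly_diff by linarith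
    qed (use e in simp)
    then show ?case using e by (simp add: op_poly_diff)
  qed
qed

lemma op_poly_Cauchy:
  assumes T: "selfadjoint T"
    and p: "uniform_limit (real_spectrum T) (\<lambda>n. poly (p n)) f sequentially"
  shows "Cauchy (\<lambda>n. op_poly (p n) T)"
proof (rule metric_CauchyI)
  fix e :: real assume e: "e > 0"
  then have "e / 4 > 0" by simp
  then obtain N where N: "\<And>n x. n \<ge> N \<Longrightarrow> x \<in> real_spectrum T \<Longrightarrow> dist (poly (p n) x) (f x) < e / 4"
    using p unfolding uniform_limit_sequentially_iff by metis
  have "dist (op_poly (p m) T) (op_poly (p n) T) < e" if mn: "m \<ge> N" "n \<ge> N" for m n
  proof -
    have "norm (op_poly (p m - p n) T) \<le> e / 2"
    proof (rule norm_op_poly_le[OF T])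
      show "\<bar>poly (p m - p n) x\<bar> \<le> e / 2" if "x \<in> real_spectrum T" for x
        using N[OF mn(1) that] N[OF mn(2) that] unfolding dist_real_def poly_diff by linarith
    qed (use e in simp)
    then show ?thesis using e by (simp add: op_poly_diff dist_norm)
  qed
  then show "\<exists>N. \<forall>m\<ge>N. \<forall>n\<ge>N. dist (op_poly (p m) T) (op_poly (p n) T) < e" by blast
qed

text \<open>This turns the definite description of \<open>f(T)\<close> into a usable limit. The spectral bound makes the values
of approximating polynomials a Cauchy sequence, any two approximating sequences have the same limit,
and one approximating sequence exists by Weierstrass, so the limit is unique.\<close>

theorem fun_calc_tendsto:
  assumes T: "op_between c T M" and f: "continuous_on {c..M} f"
    and p: "uniform_limit {c..M} (\<lambda>n. poly (p n)) f sequentially"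
  shows "(\<lambda>n. op_poly (p n) T) \<longlonglongrightarrow> fun_calc f T"
proof -
  have sa: "selfadjoint T" using T by (rule op_between_selfadjoint)
  have pS: "uniform_limit (real_spectrum T) (\<lambda>n. poly (p n)) f sequentially"
    using p real_spectrum_subset[OF T] by (rule uniform_limit_on_subset)
  obtain S where S: "(\<lambda>n. op_poly (p n) T) \<longlonglongrightarrow> S"
    using op_poly_Cauchy[OF sa pS] Cauchy_convergent convergent_def by blast
  have "fun_calc f T = S"
    unfolding fun_calc_def real_spectrum_eq
  proof (rule the_equality, intro allI impI)
    fix q assume "uniform_limit (real_spectrum T) (\<lambda>n. poly (q n)) f sequentially"
    from tendsto_diff[OF S op_poly_diff_tendsto_0[OF sa pS this]]
    show "(\<lambda>n. op_poly (q n) T) \<longlonglongrightarrow> S" by simp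
  next
    fix S' assume "\<forall>q. uniform_limit (real_spectrum T) (\<lambda>n. poly (q n)) f sequentially \<longrightarrow>
      (\<lambda>n. op_poly (q n) T) \<longlonglongrightarrow> S'"
    then show "S' = S" using pS S LIMSEQ_unique by blast
  qed
  then show ?thesis using S by simp
qed

lemma fun_calc_poly:
  assumes T: "op_between c T M"
  shows "fun_calc (poly q) T = op_poly q T"
proof -
  have "continuous_on {c..M} (poly q)" by (intro continuous_intros)
  from fun_calc_tendsto[OF T this uniform_limit_const]
  show ?thesis by (simp add: LIMSEQ_const_iff)
qed

lemma fun_calc_cong:
  assumes T: "op_between c T M" and f: "continuous_on {c..M} f"
    and eq: "\<And>x. x \<in> {c..M} \<Longrightarrow> f x = g x"
  shows "fun_calc f T = fun_calc g T"
proof -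
  obtain p where p: "uniform_limit {c..M} (\<lambda>n. poly (p n)) f sequentially"
    by (rule Weierstrass_poly_sequence[OF f])
  have g: "continuous_on {c..M} g" using f eq continuous_on_cong by blast
  have "uniform_limit {c..M} (\<lambda>n. poly (p n)) g sequentially"
    using p eq by (auto simp: uniform_limit_iff)
  then show ?thesis
    using fun_calc_tendsto[OF T f p] fun_calc_tendsto[OF T g] LIMSEQ_unique by blast
qed

lemma fun_calc_add:
  assumes T: "op_between c T M" and f: "continuous_on {c..M} f" and g: "continuous_on {c..M} g"
  shows "fun_calc (\<lambda>x. f x + g x) T = fun_calc f T + fun_calc g T"
proof -
  obtain p where p: "uniform_limit {c..M} (\<lambda>n. poly (p n)) f sequentially"
    by (rule Weierstrass_poly_sequence[OF f])
  obtain q where q: "uniform_limit {c..M} (\<lambda>n. poly (q n)) g sequentially"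
    by (rule Weierstrass_poly_sequence[OF g])
  have "uniform_limit {c..M} (\<lambda>n. poly (p n + q n)) (\<lambda>x. f x + g x) sequentially"
    using uniform_limit_add[OF p q] by (simp add: uniform_limit_iff)
  from fun_calc_tendsto[OF T continuous_on_add[OF f g] this]
  have "(\<lambda>n. op_poly (p n) T + op_poly (q n) T) \<longlonglongrightarrow> fun_calc (\<lambda>x. f x + g x) T"
    by (simp add: op_poly_add)
  then show ?thesis
    using tendsto_add[OF fun_calc_tendsto[OF T f p] fun_calc_tendsto[OF T g q]] LIMSEQ_unique by blast
qed

lemma fun_calc_mult:
  assumes T: "op_between c T M" and f: "continuous_on {c..M} f" and g: "continuous_on {c..M} g"
  shows "fun_calc (\<lambda>x. f x * g x) T = fun_calc f T o\<^sub>L fun_calc g T"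
proof -
  obtain p where p: "uniform_limit {c..M} (\<lambda>n. poly (p n)) f sequentially"
    by (rule Weierstrass_poly_sequence[OF f])
  obtain q where q: "uniform_limit {c..M} (\<lambda>n. poly (q n)) g sequentially"
    by (rule Weierstrass_poly_sequence[OF g])
  have "bounded (f ` {c..M})" "bounded (g ` {c..M})"
    using f g by (simp_all add: compact_continuous_image compact_imp_bounded)
  from uniform_lim_mult[OF p q this]
  have "uniform_limit {c..M} (\<lambda>n. poly (p n * q n)) (\<lambda>x. f x * g x) sequentially"
    by (simp add: uniform_limit_iff)
  from fun_calc_tendsto[OF T continuous_on_mult[OF f g] this]
  have "(\<lambda>n. op_poly (p n) T o\<^sub>L op_poly (q n) T) \<longlonglongrightarrow> fun_calc (\<lambda>x. f x * g x) T"
    by (simp add: op_poly_mult)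
  moreover have "(\<lambda>n. op_poly (p n) T o\<^sub>L op_poly (q n) T) \<longlonglongrightarrow> (fun_calc f T o\<^sub>L fun_calc g T)"
    by (intro bounded_bilinear.tendsto[OF bounded_bilinear_blinfun_compose]
        fun_calc_tendsto[OF T] f g p q)
  ultimately show ?thesis by (rule LIMSEQ_unique)
qed

lemma tendsto_rip:
  assumes "S \<longlonglongrightarrow> T" "R \<longlonglongrightarrow> T'"
  shows "(\<lambda>n. rip (S n) (R n)) \<longlonglongrightarrow> rip T T'"
proof -
  have rip_polar: "rip x y = ((norm (x + y))\<^sup>2 - (norm x)\<^sup>2 - (norm y)\<^sup>2) / 2" for x y :: 'a
    unfolding rip_self[symmetric] by (simp add: rip_simps rip_commute)
  show ?thesis unfolding rip_polar by (intro tendsto_intros assms) simp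
qed

lemma tendsto_scaleC:
  fixes X :: "nat \<Rightarrow> 'a::complex_hilbert_space"
  shows "X \<longlonglongrightarrow> x \<Longrightarrow> (\<lambda>n. c *\<^sub>C X n) \<longlonglongrightarrow> c *\<^sub>C x"
  by (rule bounded_linear.tendsto[OF bounded_linear_scaleC])

lemma selfadjoint_limit:
  fixes S :: "nat \<Rightarrow> 'a::complex_hilbert_space \<Rightarrow>\<^sub>L 'a"
  assumes lim: "S \<longlonglongrightarrow> T" and sa: "\<And>n. selfadjoint (S n)"
  shows "selfadjoint T"
  unfolding selfadjoint_iff cops_def mem_Collect_eq
proof (intro conjI allI)
  have pt: "(\<lambda>n. S n x) \<longlonglongrightarrow> T x" for x
    by (intro blinfun.tendsto lim tendsto_const)
  show "T (c *\<^sub>C x) = c *\<^sub>C T x" for c x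
    using pt[of "c *\<^sub>C x"] tendsto_scaleC[OF pt[of x], of c] copsD[OF selfadjoint_cops[OF sa]]
    by (simp add: LIMSEQ_unique)
  show "rip (T x) y = rip x (T y)" for x y
    using tendsto_rip[OF pt[of x] tendsto_const[of y]] tendsto_rip[OF tendsto_const[of x] pt[of y]]
      selfadjoint_rip[OF sa] by (simp add: LIMSEQ_unique)
qed

lemma fun_calc_selfadjoint:
  assumes T: "op_between c T M" and f: "continuous_on {c..M} f"
  shows "selfadjoint (fun_calc f T)"
proof -
  obtain p where "uniform_limit {c..M} (\<lambda>n. poly (p n)) f sequentially"
    by (rule Weierstrass_poly_sequence[OF f])
  from fun_calc_tendsto[OF T f this] show ?thesis
    by (rule selfadjoint_limit) (intro op_poly_selfadjoint op_between_selfadjoint[OF T])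
qed

text \<open>The operator is the square of the self-adjoint operator obtained from the square root of \<open>f\<close>.\<close>

lemma fun_calc_nonneg:
  assumes T: "op_between c T M" and f: "continuous_on {c..M} f"
    and pos: "\<And>x. x \<in> {c..M} \<Longrightarrow> 0 \<le> f x"
  shows "0 \<le> rip (fun_calc f T y) y"
proof -
  have g: "continuous_on {c..M} (\<lambda>x. sqrt (f x))"
    by (intro continuous_on_real_sqrt f)
  have "fun_calc f T = fun_calc (\<lambda>x. sqrt (f x) * sqrt (f x)) T"
    by (rule fun_calc_cong[OF T f]) (simp add: pos)
  also have "\<dots> = fun_calc (\<lambda>x. sqrt (f x)) T o\<^sub>L fun_calc (\<lambda>x. sqrt (f x)) T"
    by (rule fun_calc_mult[OF T g g])
  finally show ?thesis
    using selfadjoint_rip[OF fun_calc_selfadjoint[OF T g]] by (simp add: rip_self)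
qed

lemma fun_calc_const:
  assumes T: "op_between c T M"
  shows "fun_calc (\<lambda>_. a) T = a *\<^sub>R id_blinfun"
proof -
  have "poly [:a:] = (\<lambda>_. a)" by auto
  then show ?thesis using fun_calc_poly[OF T, of "[:a:]"] by (simp add: op_poly_const)
qed

lemma fun_calc_id:
  assumes T: "op_between c T M"
  shows "fun_calc (\<lambda>x. x) T = T"
proof -
  have "poly [:0, 1:] = (\<lambda>x. x::real)" by auto
  then show ?thesis using fun_calc_poly[OF T, of "[:0, 1:]"] by (simp add: op_poly_X)
qed

lemma fun_calc_scale:
  assumes T: "op_between c T M" and f: "continuous_on {c..M} f"
  shows "fun_calc (\<lambda>x. a * f x) T = a *\<^sub>R fun_calc f T"
  unfolding fun_calc_mult[OF T continuous_on_const f] fun_calc_const[OF T]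
  by (intro blinfun_eqI) (simp add: blinfun.bilinear_simps)

lemma fun_calc_mono:
  assumes T: "op_between c T M" and f: "continuous_on {c..M} f" and g: "continuous_on {c..M} g"
    and le: "\<And>x. x \<in> {c..M} \<Longrightarrow> f x \<le> g x"
  shows "rip (fun_calc f T y) y \<le> rip (fun_calc g T y) y"
proof -
  have mf: "continuous_on {c..M} (\<lambda>x. (-1) * f x)" by (intro continuous_intros f)
  have "0 \<le> rip (fun_calc (\<lambda>x. g x + (-1) * f x) T y) y"
    by (rule fun_calc_nonneg[OF T]) (auto intro!: continuous_intros f g le)
  then show ?thesis
    unfolding fun_calc_add[OF T g mf] fun_calc_scale[OF T f]
    by (simp add: blinfun.bilinear_simps rip_simps)
qed

lemma fun_calc_between:
  assumes T: "op_between c T M" and f: "continuous_on {c..M} f"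
    and le: "\<And>x. x \<in> {c..M} \<Longrightarrow> a \<le> f x" "\<And>x. x \<in> {c..M} \<Longrightarrow> f x \<le> b"
  shows "op_between a (fun_calc f T) b"
  using fun_calc_mono[OF T continuous_on_const f le(1)] fun_calc_mono[OF T f continuous_on_const le(2)]
  by (simp add: op_between_def fun_calc_selfadjoint[OF T f] fun_calc_const[OF T]
      blinfun.bilinear_simps rip_simps rip_self)

lemma norm_fun_calc_le:
  assumes T: "op_between c T M" and f: "continuous_on {c..M} f" and e: "e \<ge> 0"
    and le: "\<And>x. x \<in> {c..M} \<Longrightarrow> \<bar>f x\<bar> \<le> e"
  shows "norm (fun_calc f T) \<le> e"
proof (rule norm_blinfun_bound[OF e])
  fix y
  have "(norm (fun_calc f T y))\<^sup>2 = rip (fun_calc (\<lambda>x. f x * f x) T y) y"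
    unfolding fun_calc_mult[OF T f f]
    using selfadjoint_rip[OF fun_calc_selfadjoint[OF T f]] by (simp add: rip_self)
  also have "\<dots> \<le> rip (fun_calc (\<lambda>_. e * e) T y) y"
  proof (rule fun_calc_mono[OF T])
    show "f x * f x \<le> e * e" if "x \<in> {c..M}" for x
      using le[OF that] e by (simp flip: power2_eq_square abs_le_square_iff)
  qed (intro continuous_intros f)+
  also have "\<dots> = (e * norm y)\<^sup>2"
    unfolding fun_calc_const[OF T]
    by (simp add: blinfun.bilinear_simps rip_simps rip_self power2_eq_square)
  finally show "norm (fun_calc f T y) \<le> e * norm y"
    by (rule power2_le_imp_le) (use e in simp)
qed

lemma norm_fun_calc_diff_le:
  assumes T: "op_between c T M" and f: "continuous_on {c..M} f" and g: "continuous_on {c..M} g"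
    and e: "e \<ge> 0" and le: "\<And>x. x \<in> {c..M} \<Longrightarrow> \<bar>f x - g x\<bar> \<le> e"
  shows "norm (fun_calc f T - fun_calc g T) \<le> e"
proof -
  have mg: "continuous_on {c..M} (\<lambda>x. (-1) * g x)" by (intro continuous_intros g)
  have "norm (fun_calc (\<lambda>x. f x + (-1) * g x) T) \<le> e"
    by (rule norm_fun_calc_le[OF T _ e]) (auto intro!: continuous_intros f g le)
  then show ?thesis
    unfolding fun_calc_add[OF T f mg] fun_calc_scale[OF T g] by simp
qed

lemma fun_calc_tendsto_uniform:
  assumes T: "op_between c T M" and h: "\<And>n. continuous_on {c..M} (h n)" and f: "continuous_on {c..M} f"
    and lim: "uniform_limit {c..M} h f sequentially"
  shows "(\<lambda>n. fun_calc (h n) T) \<longlonglongrightarrow> fun_calc f T"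
proof (rule tendstoI)
  fix e :: real assume e: "e > 0"
  then have "e / 2 > 0" by simp
  from uniform_limitD[OF lim this]
  show "\<forall>\<^sub>F n in sequentially. dist (fun_calc (h n) T) (fun_calc f T) < e"
  proof eventually_elim
    case (elim n)
    have "norm (fun_calc (h n) T - fun_calc f T) \<le> e / 2"
      by (rule norm_fun_calc_diff_le[OF T h f]) (use e elim in \<open>auto simp: dist_real_def intro: less_imp_le\<close>)
    then show ?case using e by (simp add: dist_norm)
  qed
qed

text \<open>Both sides are continuous in \<open>f\<close> for uniform convergence, and for polynomial \<open>f\<close> they agree because
the calculus is multiplicative.\<close>

lemma fun_calc_compose:
  assumes T: "op_between c T M" and g: "continuous_on {c..M} g"
    and im: "\<And>x. x \<in> {c..M} \<Longrightarrow> g x \<in> {c'..M'}" and f: "continuous_on {c'..M'} f"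
  shows "fun_calc f (fun_calc g T) = fun_calc (\<lambda>x. f (g x)) T"
proof -
  have G: "op_between c' (fun_calc g T) M'"
    by (rule fun_calc_between[OF T g]) (use im in auto)
  have pg: "continuous_on {c..M} (\<lambda>x. poly p (g x))" for p
    by (intro continuous_intros g)
  have poly: "op_poly p (fun_calc g T) = fun_calc (\<lambda>x. poly p (g x)) T" for p
  proof (induction p)
    case 0
    then show ?case using fun_calc_const[OF T, of 0] by simp
  next
    case (pCons a p)
    then show ?case
      using fun_calc_add[OF T continuous_on_const continuous_on_mult[OF g pg]]
        fun_calc_mult[OF T g pg] fun_calc_const[OF T]
      by (simp add: op_poly_pCons)
  qed
  obtain p where p: "uniform_limit {c'..M'} (\<lambda>n. poly (p n)) f sequentially"
    by (rule Weierstrass_poly_sequence[OF f])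
  have "uniform_limit {c..M} (\<lambda>n x. poly (p n) (g x)) (\<lambda>x. f (g x)) sequentially"
    using im by (auto intro: uniform_limit_compose'[OF p])
  moreover have "continuous_on {c..M} (\<lambda>x. f (g x))"
    by (rule continuous_on_compose2[OF f g]) (use im in auto)
  ultimately have "(\<lambda>n. op_poly (p n) (fun_calc g T)) \<longlonglongrightarrow> fun_calc (\<lambda>x. f (g x)) T"
    unfolding poly by (intro fun_calc_tendsto_uniform[OF T pg])
  then show ?thesis
    using fun_calc_tendsto[OF G f p] LIMSEQ_unique by blast
qed


section \<open>Real powers of positive definite operators\<close>

lemma pos_def_between:
  assumes "A \<in> pos_def_ops"
  obtains c M where "0 < c" "op_between c A M"
proof -
  obtain c where c: "c > 0" "\<And>x. c * (norm x)\<^sup>2 \<le> rip (A x) x" and sa: "selfadjoint A"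
    using assms by (auto simp: pos_def_ops_iff)
  have "rip (A x) x \<le> norm A * (norm x)\<^sup>2" for x
    unfolding power2_eq_square mult.assoc[symmetric]
    by (meson norm_blinfun rip_le_norm mult_right_mono norm_ge_zero order_trans)
  then show ?thesis using that[of c "norm A"] c sa by (simp add: op_between_def)
qed

lemma pos_def_selfadjoint: "A \<in> pos_def_ops \<Longrightarrow> selfadjoint A"
  by (simp add: pos_def_ops_iff)

lemma continuous_on_powr_interval: "0 < c \<Longrightarrow> continuous_on {c..M} (\<lambda>x::real. x powr s)"
  by (intro continuous_intros) auto

lemma op_powr_add:
  assumes "A \<in> pos_def_ops"
  shows "op_powr A (s + r) = op_powr A s o\<^sub>L op_powr A r"
proof -
  obtain c M where c: "0 < c" and A: "op_between c A M" by (rule pos_def_between[OF assms])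
  show ?thesis
    unfolding op_powr_def powr_add
    by (intro fun_calc_mult[OF A] continuous_on_powr_interval c)
qed

lemma op_powr_add_apply:
  "A \<in> pos_def_ops \<Longrightarrow> op_powr A s (op_powr A r x) = op_powr A (s + r) x"
  by (simp add: op_powr_add)

lemma op_powr_0:
  assumes "A \<in> pos_def_ops"
  shows "op_powr A 0 = id_blinfun"
proof -
  obtain c M where c: "0 < c" and A: "op_between c A M" by (rule pos_def_between[OF assms])
  have "op_powr A 0 = fun_calc (\<lambda>_. 1) A"
    unfolding op_powr_def
    by (rule fun_calc_cong[OF A continuous_on_powr_interval[OF c]]) (use c in auto)
  then show ?thesis by (simp add: fun_calc_const[OF A])
qed

lemma op_powr_1:
  assumes "A \<in> pos_def_ops"
  shows "op_powr A 1 = A"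
proof -
  obtain c M where c: "0 < c" and A: "op_between c A M" by (rule pos_def_between[OF assms])
  have "op_powr A 1 = fun_calc (\<lambda>x. x) A"
    unfolding op_powr_def
    by (rule fun_calc_cong[OF A continuous_on_powr_interval[OF c]]) (use c in auto)
  then show ?thesis by (simp add: fun_calc_id[OF A])
qed

lemma op_powr_selfadjoint:
  assumes "A \<in> pos_def_ops"
  shows "selfadjoint (op_powr A s)"
proof -
  obtain c M where c: "0 < c" and A: "op_between c A M" by (rule pos_def_between[OF assms])
  show ?thesis
    unfolding op_powr_def by (rule fun_calc_selfadjoint[OF A continuous_on_powr_interval[OF c]])
qed

text \<open>Splitting \<open>A\<^sup>s\<close> into two equal self-adjoint factors turns inequalities between quadratic forms into
inequalities between norms.\<close>

lemma rip_op_powr: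
  assumes A: "A \<in> pos_def_ops"
  shows "rip (op_powr A s x) x = (norm (op_powr A (s/2) x))\<^sup>2"
proof -
  have "op_powr A s x = op_powr A (s/2) (op_powr A (s/2) x)"
    by (simp add: op_powr_add_apply[OF A])
  then show ?thesis by (simp add: selfadjoint_rip[OF op_powr_selfadjoint[OF A]] rip_self)
qed

lemma op_powr_is_op_inverse:
  assumes A: "A \<in> pos_def_ops"
  shows "is_op_inverse (op_powr A s) (op_powr A (- s))"
  unfolding is_op_inverse_def
  using op_powr_add[OF A, of s "- s"] op_powr_add[OF A, of "- s" s] op_powr_0[OF A]
    op_powr_selfadjoint[OF A] by auto

lemma op_powr_pos_def:
  assumes A: "A \<in> pos_def_ops"
  shows "op_powr A s \<in> pos_def_ops"
  unfolding pos_def_ops_def pos_semidef_iff op_invertible_def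
  using op_powr_selfadjoint[OF A] op_powr_is_op_inverse[OF A] by (auto simp: rip_op_powr[OF A])

lemma op_inverse_eq_op_powr: "A \<in> pos_def_ops \<Longrightarrow> op_inverse A = op_powr A (- 1)"
  using op_inverse_eqI[OF op_powr_is_op_inverse, of A 1] by (simp add: op_powr_1)

lemma op_powr_op_inverse:
  assumes A: "A \<in> pos_def_ops"
  shows "op_powr (op_inverse A) s = op_powr A (- s)"
proof -
  obtain c M' where c: "0 < c" and T': "op_between c A M'" by (rule pos_def_between[OF A])
  \<comment> \<open>On the zero space \<open>M'\<close> may be any number. Enlarging it to a positive one keeps the
    interval of inverses inside the positive reals.\<close>
  define M where "M = max c M'"
  have "M' * (norm x)\<^sup>2 \<le> M * (norm x)\<^sup>2" for x :: 'a
    by (intro mult_right_mono) (auto simp: M_def)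
  then have T: "op_between c A M"
    using T' by (auto simp: op_between_def intro: order_trans)
  have M: "0 < M" using c by (simp add: M_def)
  have "op_powr (op_inverse A) s = fun_calc (\<lambda>x. x powr s) (fun_calc (\<lambda>x. x powr - 1) A)"
    by (simp add: op_inverse_eq_op_powr[OF A] op_powr_def)
  also have "\<dots> = fun_calc (\<lambda>x. (x powr - 1) powr s) A"
  proof (rule fun_calc_compose[OF T continuous_on_powr_interval[OF c]])
    show "x powr - 1 \<in> {M powr - 1..c powr - 1}" if "x \<in> {c..M}" for x
      using that c by (auto intro!: frac_le)
    show "continuous_on {M powr - 1..c powr - 1} (\<lambda>x. x powr s)"
      using M by (intro continuous_on_powr_interval) simp
  qed
  also have "\<dots> = op_powr A (- s)"
    by (simp only: op_powr_def powr_powr) simp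
  finally show ?thesis .
qed

lemma op_powr_scale:
  assumes A: "A \<in> pos_def_ops" and b: "b > 0"
  shows "op_powr (b *\<^sub>R A) s = b powr s *\<^sub>R op_powr A s"
proof -
  obtain c M where c: "0 < c" and T: "op_between c A M" by (rule pos_def_between[OF A])
  have "fun_calc (\<lambda>x. b * x) A = b *\<^sub>R A"
    using fun_calc_scale[OF T continuous_on_id] fun_calc_id[OF T] by simp
  then have "op_powr (b *\<^sub>R A) s = fun_calc (\<lambda>x. x powr s) (fun_calc (\<lambda>x. b * x) A)"
    by (simp add: op_powr_def)
  also have "\<dots> = fun_calc (\<lambda>x. (b * x) powr s) A"
    by (rule fun_calc_compose[OF T, of _ "b * c" "b * M"])
      (use b c in \<open>auto intro!: continuous_intros continuous_on_powr_interval\<close>)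
  also have "\<dots> = fun_calc (\<lambda>x. b powr s * x powr s) A"
    by (rule fun_calc_cong[OF T]) (use b c in \<open>auto intro!: continuous_intros simp: powr_mult\<close>)
  also have "\<dots> = b powr s *\<^sub>R op_powr A s"
    unfolding op_powr_def by (rule fun_calc_scale[OF T continuous_on_powr_interval[OF c]])
  finally show ?thesis .
qed

text \<open>On a compact set of exponents and positive bases, \<open>x powr r\<close> is uniformly continuous.\<close>

lemma op_powr_tendsto:
  assumes A: "A \<in> pos_def_ops" and lim: "t \<longlonglongrightarrow> s" and t: "\<And>n. t n \<in> {0..1}" and s: "s \<in> {0..1}"
  shows "(\<lambda>n. op_powr A (t n)) \<longlonglongrightarrow> op_powr A s"
proof -
  obtain c M where c: "0 < c" and T: "op_between c A M" by (rule pos_def_between[OF A])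
  have "continuous_on ({0..1} \<times> {c..M}) (\<lambda>(r, x). x powr r)"
    using c by (auto simp: case_prod_unfold intro!: continuous_intros)
  then have uc: "uniformly_continuous_on ({0..1} \<times> {c..M}) (\<lambda>(r, x). x powr r)"
    by (intro compact_uniformly_continuous compact_Times) auto
  have "uniform_limit {c..M} (\<lambda>n x. x powr t n) (\<lambda>x. x powr s) sequentially"
  proof (rule uniform_limitI)
    fix e :: real assume "e > 0"
    then obtain d where d: "d > 0" "\<And>p q. p \<in> {0..1} \<times> {c..M} \<Longrightarrow> q \<in> {0..1} \<times> {c..M} \<Longrightarrow>
        dist q p < d \<Longrightarrow> dist (snd q powr fst q) (snd p powr fst p) < e"
      using uc unfolding uniformly_continuous_on_def case_prod_unfold by metis
    from tendstoD[OF lim d(1)]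
    show "\<forall>\<^sub>F n in sequentially. \<forall>x\<in>{c..M}. dist (x powr t n) (x powr s) < e"
    proof eventually_elim
      case (elim n)
      show ?case
        using d(2)[of "(s, _)" "(t n, _)"] elim t s by (auto simp: dist_Pair_Pair)
    qed
  qed
  then show ?thesis
    unfolding op_powr_def
    by (intro fun_calc_tendsto_uniform[OF T] continuous_on_powr_interval c)
qed

lemma rip_op_powr_le:
  assumes A: "A \<in> pos_def_ops" and up: "\<And>x. rip (A x) x \<le> \<alpha> * (norm x)\<^sup>2" and s: "s \<ge> 0"
  shows "rip (op_powr A s x) x \<le> \<alpha> powr s * (norm x)\<^sup>2"
proof -
  obtain c M where c: "0 < c" and T: "op_between c A M" by (rule pos_def_between[OF A])
  then have T: "op_between c A \<alpha>" using up by (simp add: op_between_def)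
  have "op_between 0 (op_powr A s) (\<alpha> powr s)"
    unfolding op_powr_def
    by (rule fun_calc_between[OF T continuous_on_powr_interval[OF c]])
      (use c s in \<open>auto intro!: powr_mono2\<close>)
  then show ?thesis by (simp add: op_between_def)
qed


section \<open>The Loewner--Heinz inequality\<close>

text \<open>For self-adjoint \<open>Q\<close> the numbers \<open>\<parallel>Q\<^sup>n x\<parallel>\<close> are logarithmically convex in \<open>n\<close>, so one step of growth by a
factor \<open>r > 1\<close> forces growth like \<open>r\<^sup>n\<close>. But \<open>Q\<^sup>n\<close> is similar to \<open>K\<^sup>n\<close> by a fixed similarity and stays
bounded.\<close>

lemma selfadjoint_similar_to_contraction:
  fixes Q K D D' :: "'a::complex_hilbert_space \<Rightarrow>\<^sub>L 'a"
  assumes Q: "selfadjoint Q" and K: "\<And>x. norm (K x) \<le> norm x"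
    and sim: "\<And>x. Q x = D (K (D' x))" and inv: "\<And>x. D' (D x) = x" "\<And>x. D (D' x) = x"
  shows "norm (Q x) \<le> norm x"
proof (rule ccontr)
  assume "\<not> ?thesis"
  then have less: "norm x < norm (Q x)" by simp
  have x: "norm x > 0" using less by (cases "x = 0") auto
  define r where "r = norm (Q x) / norm x"
  have r: "r > 1" using less x by (simp add: r_def)
  define a where "a n = norm ((blinfun_apply Q ^^ n) x)" for n
  have logconvex: "(a (Suc n))\<^sup>2 \<le> a n * a (Suc (Suc n))" for n
    using rip_le_norm[of "(blinfun_apply Q ^^ n) x" "(blinfun_apply Q ^^ Suc (Suc n)) x"]
    by (simp add: a_def selfadjoint_rip[OF Q, symmetric] rip_self)
  have growth: "0 < a n \<and> r * a n \<le> a (Suc n)" for n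
  proof (induction n)
    case 0
    then show ?case using x by (simp add: a_def r_def)
  next
    case (Suc n)
    then have pos: "a (Suc n) > 0"
      using r by (smt (verit) mult_pos_pos)
    have "r * a n * a (Suc n) \<le> a (Suc n) * a (Suc n)"
      using Suc pos by (intro mult_right_mono) auto
    also have "\<dots> \<le> a n * a (Suc (Suc n))"
      using logconvex[of n] by (simp add: power2_eq_square)
    finally have "a n * (r * a (Suc n)) \<le> a n * a (Suc (Suc n))" by (simp add: ac_simps)
    then show ?case using pos Suc by simp
  qed
  have lower: "r ^ n * norm x \<le> a n" for n
  proof (induction n)
    case 0
    then show ?case by (simp add: a_def)
  next
    case (Suc n)
    have "r * (r ^ n * norm x) \<le> r * a n" using Suc r by (intro mult_left_mono) auto
    then show ?case using growth[of n] by (simp add: mult.assoc)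
  qed
  have pow: "(blinfun_apply Q ^^ n) x = D ((blinfun_apply K ^^ n) (D' x))" for n
    by (induction n) (simp_all add: sim inv)
  have Kn: "norm ((blinfun_apply K ^^ n) y) \<le> norm y" for n y
    by (induction n) (auto intro: order_trans[OF K])
  have upper: "a n \<le> norm D * norm (D' x)" for n
    unfolding a_def pow
    by (rule order_trans[OF norm_blinfun]) (intro mult_left_mono Kn norm_ge_zero)
  obtain n where "norm D * norm (D' x) / norm x < r ^ n"
    using real_arch_pow[OF r] by blast
  then show False
    using lower[of n] upper[of n] x by (simp add: divide_less_eq)
qed

text \<open>If \<open>V\<close> is the adjoint of \<open>U\<close>, then \<open>\<parallel>V y\<parallel>\<^sup>2\<close> is the inner product of \<open>U (V y)\<close> and \<open>y\<close>.\<close>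

lemma adjoint_norm_bound:
  fixes U V :: "'a::complex_hilbert_space \<Rightarrow> 'a"
  assumes U: "\<And>x. norm (U x) \<le> C * norm x" and adj: "\<And>x y. rip (U x) y = rip x (V y)"
  shows "norm (V y) \<le> C * norm y"
proof (cases "V y = 0")
  case True
  then show ?thesis using U[of y] by (metis norm_ge_zero norm_zero order_trans)
next
  case False
  have "norm (V y) * norm (V y) = rip (U (V y)) y"
    by (simp add: adj rip_self power2_eq_square)
  also have "\<dots> \<le> norm (U (V y)) * norm y" by (rule rip_le_norm)
  also have "\<dots> \<le> C * norm (V y) * norm y" by (intro mult_right_mono U) auto
  finally have "norm (V y) * norm (V y) \<le> norm (V y) * (C * norm y)" by (simp add: ac_simps)
  then show ?thesis using False by simp
qed

text \<open>Pedersen's argument. The hypotheses say that \<open>X\<^bsup>a/2\<^esup> Y\<^bsup>-a/2\<^esup>\<close> and \<open>X\<^bsup>b/2\<^esup> Y\<^bsup>-b/2\<^esup>\<close> are contractions. The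
adjoint of the first times the second is the contraction \<open>K = Y\<^bsup>-a/2\<^esup> X\<^sup>m Y\<^bsup>-b/2\<^esup>\<close> with \<open>m = (a + b)/2\<close>.
It is similar, by a power of \<open>Y\<close>, to the self-adjoint \<open>Q = Y\<^bsup>-m/2\<^esup> X\<^sup>m Y\<^bsup>-m/2\<^esup>\<close>, so \<open>Q \<le> 1\<close>, which is the
claim.\<close>

lemma op_powr_mono_midpoint:
  fixes X Y :: "'a::complex_hilbert_space \<Rightarrow>\<^sub>L 'a"
  assumes X: "X \<in> pos_def_ops" and Y: "Y \<in> pos_def_ops"
    and a: "\<And>x. rip (op_powr X a x) x \<le> rip (op_powr Y a x) x"
    and b: "\<And>x. rip (op_powr X b x) x \<le> rip (op_powr Y b x) x"
  shows "rip (op_powr X ((a + b) / 2) x) x \<le> rip (op_powr Y ((a + b) / 2) x) x"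
proof -
  note Xa = op_powr_add_apply[OF X] and Ya = op_powr_add_apply[OF Y]
  note Xs = selfadjoint_rip[OF op_powr_selfadjoint[OF X]]
    and Ys = selfadjoint_rip[OF op_powr_selfadjoint[OF Y]]
  have contr: "norm (op_powr X (s/2) (op_powr Y (- (s/2)) x)) \<le> 1 * norm x"
    if "\<And>x. rip (op_powr X s x) x \<le> rip (op_powr Y s x) x" for s x
  proof -
    have "(norm (op_powr X (s/2) (op_powr Y (- (s/2)) x)))\<^sup>2
        \<le> (norm (op_powr Y (s/2) (op_powr Y (- (s/2)) x)))\<^sup>2"
      using that by (simp add: rip_op_powr[OF X] rip_op_powr[OF Y])
    then show ?thesis by (simp add: Ya op_powr_0[OF Y] power2_le_iff_abs_le)
  qed
  have contr': "norm (op_powr Y (- (a/2)) (op_powr X (a/2) x)) \<le> 1 * norm x" for x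
    by (rule adjoint_norm_bound[OF contr[OF a]]) (simp add: Xs Ys)
  define m where "m = (a + b) / 2"
  define Q where "Q = op_powr Y (- (m/2)) o\<^sub>L op_powr X m o\<^sub>L op_powr Y (- (m/2))"
  define K where "K = op_powr Y (- (a/2)) o\<^sub>L op_powr X m o\<^sub>L op_powr Y (- (b/2))"
  \<comment> \<open>The exponent of the similarity: \<open>d - a/2\<close> and \<open>- b/2 - d\<close> must both equal \<open>- m/2\<close>.\<close>
  define d where "d = (a - b) / 4"
  have "norm (Q y) \<le> norm y" for y
  proof (rule selfadjoint_similar_to_contraction)
    show "selfadjoint Q"
      unfolding Q_def
      by (rule selfadjoint_congruence[OF op_powr_selfadjoint[OF Y] op_powr_selfadjoint[OF X]])
    show "norm (K x) \<le> norm x" for x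
    proof -
      have "K x = op_powr Y (- (a/2)) (op_powr X (a/2) (op_powr X (b/2) (op_powr Y (- (b/2)) x)))"
        by (simp add: K_def Xa m_def add_divide_distrib)
      also have "norm \<dots> \<le> norm (op_powr X (b/2) (op_powr Y (- (b/2)) x))"
        using contr' by simp
      also have "\<dots> \<le> norm x" using contr[OF b] by simp
      finally show ?thesis .
    qed
    have "d - a / 2 = - (m / 2)" "- (b / 2) - d = - (m / 2)"
      by (simp_all add: d_def m_def field_simps)
    then show "Q x = op_powr Y d (K (op_powr Y (- d) x))" for x
      by (simp add: Q_def K_def Ya)
  qed (simp_all add: Ya op_powr_0[OF Y])
  then have Q: "rip (Q y) y \<le> (norm y)\<^sup>2" for y
    using rip_le_norm[of "Q y" y] by (smt (verit) mult_right_mono norm_ge_zero power2_eq_square)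
  have "rip (op_powr X m x) x = rip (Q (op_powr Y (m/2) x)) (op_powr Y (m/2) x)"
    by (simp add: Q_def Ys Ya op_powr_0[OF Y])
  also have "\<dots> \<le> rip (op_powr Y m x) x"
    using Q by (simp add: rip_op_powr[OF Y])
  finally show ?thesis by (simp add: m_def)
qed

text \<open>The points of \<open>S\<close> next to \<open>t\<close> on its left and right are attained because \<open>S\<close> is closed. If they
differed, their midpoint would be a closer one.\<close>

lemma midpoint_closed_set_contains_interval:
  fixes S :: "real set"
  assumes "closed S" "l \<in> S" "u \<in> S"
    and mid: "\<And>a b. a \<in> S \<Longrightarrow> b \<in> S \<Longrightarrow> (a + b) / 2 \<in> S"
  shows "{l..u} \<subseteq> S"
proof
  fix t assume t: "t \<in> {l..u}"
  define a b where "a = Sup (S \<inter> {l..t})" and "b = Inf (S \<inter> {t..u})"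
  have bdd: "bdd_above (S \<inter> {l..t})" "bdd_below (S \<inter> {t..u})"
    by (auto intro: bdd_above.I2 bdd_below.I2)
  have a: "a \<in> S \<inter> {l..t}" unfolding a_def
    by (rule closed_contains_Sup) (use assms t bdd in auto)
  have b: "b \<in> S \<inter> {t..u}" unfolding b_def
    by (rule closed_contains_Inf) (use assms t bdd in auto)
  have m: "(a + b) / 2 \<in> S" using a b mid by auto
  have "a = b"
  proof (cases "(a + b) / 2 \<le> t")
    case True
    then have "(a + b) / 2 \<in> S \<inter> {l..t}" using a b m by auto
    then have "(a + b) / 2 \<le> a" unfolding a_def by (rule cSup_upper[OF _ bdd(1)])
    then show ?thesis using a b by auto
  next
    case False
    then have "(a + b) / 2 \<in> S \<inter> {t..u}" using a b m by auto
    then have "b \<le> (a + b) / 2" unfolding b_def by (rule cInf_lower[OF _ bdd(2)])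
    then show ?thesis using a b by auto
  qed
  then show "t \<in> S" using a b by auto
qed

text \<open>The exponents for which the inequality holds form a closed set with midpoints that contains \<open>0\<close> and
\<open>1\<close>.\<close>

theorem Loewner_Heinz:
  fixes X Y :: "'a::complex_hilbert_space \<Rightarrow>\<^sub>L 'a"
  assumes X: "X \<in> pos_def_ops" and Y: "Y \<in> pos_def_ops"
    and le: "\<And>x. rip (X x) x \<le> rip (Y x) x" and t: "t \<in> {0..1}"
  shows "rip (op_powr X t x) x \<le> rip (op_powr Y t x) x"
proof -
  define S where "S = {s \<in> {0..1}. \<forall>x. rip (op_powr X s x) x \<le> rip (op_powr Y s x) x}"
  have "closed S"
    unfolding closed_sequential_limits
  proof (intro allI impI, elim conjE)
    fix u s assume u: "\<forall>n. u n \<in> S" and lim: "u \<longlonglongrightarrow> s"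
    have u01: "u n \<in> {0..1}" for n using u by (simp add: S_def)
    then have s: "s \<in> {0..1}" using lim closed_sequentially[OF closed_atLeastAtMost] by blast
    have "rip (op_powr X s x) x \<le> rip (op_powr Y s x) x" for x
    proof (rule LIMSEQ_le)
      show "(\<lambda>n. rip (op_powr X (u n) x) x) \<longlonglongrightarrow> rip (op_powr X s x) x"
        by (intro tendsto_rip blinfun.tendsto op_powr_tendsto[OF X lim u01 s] tendsto_const)
      show "(\<lambda>n. rip (op_powr Y (u n) x) x) \<longlonglongrightarrow> rip (op_powr Y s x) x"
        by (intro tendsto_rip blinfun.tendsto op_powr_tendsto[OF Y lim u01 s] tendsto_const)
    qed (use u in \<open>auto simp: S_def\<close>)
    then show "s \<in> S" using s by (simp add: S_def)
  qed
  moreover have "0 \<in> S" "1 \<in> S"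
    using le by (simp_all add: S_def op_powr_0[OF X] op_powr_0[OF Y] op_powr_1[OF X] op_powr_1[OF Y])
  moreover have "(a + b) / 2 \<in> S" if "a \<in> S" "b \<in> S" for a b
    using that op_powr_mono_midpoint[OF X Y, of a b] by (auto simp: S_def)
  ultimately have "{0..1} \<subseteq> S" by (rule midpoint_closed_set_contains_interval)
  then show ?thesis using t by (auto simp: S_def)
qed


section \<open>The spectral geometric mean\<close>

lemma pos_def_congruence:
  assumes S: "S \<in> pos_def_ops" and B: "B \<in> pos_def_ops"
  shows "S o\<^sub>L B o\<^sub>L S \<in> pos_def_ops"
  using assms op_invertible_compose[OF op_invertible_compose] selfadjoint_rip[of S]
  by (auto simp: pos_def_ops_def pos_semidef_iff selfadjoint_congruence)

lemma geom_mean_op_inverse: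
  assumes A: "A \<in> pos_def_ops"
  shows "geom_mean t (op_inverse A) B = op_powr A (- (1/2))
    o\<^sub>L op_powr (op_powr A (1/2) o\<^sub>L B o\<^sub>L op_powr A (1/2)) t o\<^sub>L op_powr A (- (1/2))"
  by (simp add: geom_mean_def op_powr_op_inverse[OF A])

lemma geom_mean_op_inverse_pos_def:
  assumes A: "A \<in> pos_def_ops" and B: "B \<in> pos_def_ops"
  shows "geom_mean t (op_inverse A) B \<in> pos_def_ops"
  unfolding geom_mean_op_inverse[OF A]
  by (intro pos_def_congruence op_powr_pos_def A B)

text \<open>Monotonicity of the mean in its second argument, since the right-hand side is the form of the mean
of \<open>A\<^sup>-\<^sup>1\<close> and \<open>\<beta> I\<close>: conjugating \<open>B \<le> \<beta>\<close> by \<open>A\<^bsup>1/2\<^esup>\<close> gives \<open>A\<^bsup>1/2\<^esup> B A\<^bsup>1/2\<^esup> \<le> \<beta> A\<close>, the Loewner--Heinz inequality raises this to the power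
\<open>t\<close>, and conjugating by \<open>A\<^bsup>-1/2\<^esup>\<close> finishes.\<close>

lemma geom_mean_op_inverse_le:
  fixes A B :: "'a::complex_hilbert_space \<Rightarrow>\<^sub>L 'a"
  assumes A: "A \<in> pos_def_ops" and B: "B \<in> pos_def_ops" and \<beta>: "\<beta> > 0"
    and le: "\<And>x. rip (B x) x \<le> \<beta> * (norm x)\<^sup>2" and t: "t \<in> {0..1}"
  shows "rip (geom_mean t (op_inverse A) B x) x \<le> \<beta> powr t * rip (op_powr A (t - 1) x) x"
proof -
  note adj = selfadjoint_rip[OF op_powr_selfadjoint[OF A]]
  define X where "X = op_powr A (1/2) o\<^sub>L B o\<^sub>L op_powr A (1/2)"
  have X: "X \<in> pos_def_ops"
    unfolding X_def by (intro pos_def_congruence op_powr_pos_def A B)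
  have \<beta>A: "\<beta> *\<^sub>R A \<in> pos_def_ops"
  proof -
    obtain c where c: "c > 0" "\<And>x. c * (norm x)\<^sup>2 \<le> rip (A x) x"
      using A by (auto simp: pos_def_ops_iff)
    then have "\<beta> * c > 0" "\<And>x. \<beta> * c * (norm x)\<^sup>2 \<le> rip ((\<beta> *\<^sub>R A) x) x"
      using \<beta> by (simp_all add: blinfun.bilinear_simps rip_simps)
    then show ?thesis
      using selfadjoint_scaleR[OF pos_def_selfadjoint[OF A]] by (auto simp: pos_def_ops_iff)
  qed
  have "rip (X y) y \<le> rip ((\<beta> *\<^sub>R A) y) y" for y
    using le[of "op_powr A (1/2) y"] rip_op_powr[OF A, of 1 y]
    by (simp add: X_def adj op_powr_1[OF A] blinfun.bilinear_simps rip_simps)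
  from Loewner_Heinz[OF X \<beta>A this t]
  have pow_le: "rip (op_powr X t y) y \<le> \<beta> powr t * rip (op_powr A t y) y" for y
    by (simp add: op_powr_scale[OF A \<beta>] blinfun.bilinear_simps rip_simps)
  define y where "y = op_powr A (- (1/2)) x"
  have "rip (geom_mean t (op_inverse A) B x) x = rip (op_powr X t y) y"
    by (simp add: geom_mean_op_inverse[OF A] X_def[symmetric] y_def adj)
  also have "\<dots> \<le> \<beta> powr t * rip (op_powr A t y) y" by (rule pow_le)
  also have "rip (op_powr A t y) y = rip (op_powr A (t - 1) x) x"
    unfolding y_def by (simp add: adj[symmetric] op_powr_add_apply[OF A])
  finally show ?thesis .
qed

theorem corollary3p5:
  fixes A B :: "'a::complex_hilbert_space \<Rightarrow>\<^sub>L 'a" and \<alpha> \<beta> :: real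
  assumes "A \<in> pos_def_ops" and "B \<in> pos_def_ops"
    and "\<alpha> > 0" and "\<beta> > 0"
    and "A \<le>\<^sub>L \<alpha> *\<^sub>R id_blinfun" and "B \<le>\<^sub>L \<beta> *\<^sub>R id_blinfun"
  shows "\<forall>t\<in>{0..1}. spectral_geom_mean t A B \<le>\<^sub>L (\<alpha> powr (1 - t) * \<beta> powr t) *\<^sub>R id_blinfun"
proof
  fix t :: real assume t: "t \<in> {0..1}"
  note A = assms(1) and B = assms(2)
  have A_le: "rip (A x) x \<le> \<alpha> * (norm x)\<^sup>2" and B_le: "rip (B x) x \<le> \<beta> * (norm x)\<^sup>2" for x
    using assms(5,6) by (simp_all add: loewner_le_iff blinfun.bilinear_simps rip_simps rip_self)
  define G where "G = geom_mean t (op_inverse A) B"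
  define H where "H = op_powr G (1/2)"
  define K where "K = op_powr A (1 - t)"
  define \<gamma> where "\<gamma> = \<alpha> powr (1 - t) * \<beta> powr t"
  have \<gamma>: "\<gamma> \<ge> 0" by (simp add: \<gamma>_def)
  have G: "G \<in> pos_def_ops"
    unfolding G_def by (rule geom_mean_op_inverse_pos_def[OF A B])
  have H: "selfadjoint H" and K: "selfadjoint K"
    unfolding H_def K_def by (rule op_powr_selfadjoint[OF G], rule op_powr_selfadjoint[OF A])
  have F: "spectral_geom_mean t A B = H o\<^sub>L op_powr A (2 - 2 * t) o\<^sub>L H"
    by (simp add: spectral_geom_mean_def G_def H_def)
  \<comment> \<open>The spectral geometric mean is \<open>L\<^sup>* L\<close> for \<open>L = K H\<close>, and it is the adjoint \<open>H K\<close> that is easy to bound, because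
    \<open>K H\<^sup>2 K = K G K\<close> contains no square root of \<open>G\<close>.\<close>
  have HK: "norm (H (K x)) \<le> sqrt \<gamma> * norm x" for x
  proof -
    have "(norm (H (K x)))\<^sup>2 = rip (G (K x)) (K x)"
      using rip_op_powr[OF G, of 1] by (simp add: H_def op_powr_1[OF G])
    also have "\<dots> \<le> \<beta> powr t * rip (op_powr A (t - 1) (K x)) (K x)"
      unfolding G_def by (rule geom_mean_op_inverse_le[OF A B assms(4) B_le t])
    also have "\<dots> \<le> \<beta> powr t * (\<alpha> powr (1 - t) * (norm x)\<^sup>2)"
    proof (rule mult_left_mono)
      have "rip (op_powr A (t - 1) (K x)) (K x) = rip (op_powr A (1 - t) x) x"
        by (simp add: K_def op_powr_add_apply[OF A] op_powr_0[OF A] rip_commute)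
      also have "\<dots> \<le> \<alpha> powr (1 - t) * (norm x)\<^sup>2"
        by (rule rip_op_powr_le[OF A A_le]) (use t in simp)
      finally show "rip (op_powr A (t - 1) (K x)) (K x) \<le> \<alpha> powr (1 - t) * (norm x)\<^sup>2" .
    qed simp
    finally have "(norm (H (K x)))\<^sup>2 \<le> (sqrt \<gamma> * norm x)\<^sup>2"
      using \<gamma> by (simp add: \<gamma>_def power_mult_distrib ac_simps)
    then show ?thesis by (rule power2_le_imp_le) (simp add: \<gamma>)
  qed
  have "rip (spectral_geom_mean t A B x) x \<le> \<gamma> * (norm x)\<^sup>2" for x
  proof -
    have "rip (spectral_geom_mean t A B x) x = (norm (K (H x)))\<^sup>2"
      by (simp add: F selfadjoint_rip[OF H] rip_op_powr[OF A] K_def diff_divide_distrib)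
    also have "\<dots> \<le> (sqrt \<gamma> * norm x)\<^sup>2"
      by (rule power_mono, rule adjoint_norm_bound[OF HK])
        (simp_all add: selfadjoint_rip[OF H] selfadjoint_rip[OF K])
    finally show ?thesis using \<gamma> by (simp add: power_mult_distrib)
  qed
  moreover have "selfadjoint (spectral_geom_mean t A B)"
    unfolding F by (rule selfadjoint_congruence[OF H op_powr_selfadjoint[OF A]])
  ultimately show "spectral_geom_mean t A B \<le>\<^sub>L (\<alpha> powr (1 - t) * \<beta> powr t) *\<^sub>R id_blinfun"
    by (simp add: loewner_le_iff \<gamma>_def selfadjoint_scaleR blinfun.bilinear_simps rip_simps rip_self)
qed

end
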